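(* Every two-bridge knot complement and every non-trivial two-bridge link complement is virtually fibered. That is, for every pair of coprime integers $p,q$ with $q\neq 0$, the complement $S^3-\mathbf{k}_{p/q}$ of the two-bridge knot or link $\mathbf{k}_{p/q}$ has a finite-sheeted cover that is fibered.
   Context: Fibered: a three-manifold $M$ is fibered if it fibers over the circle, i.e. $M$ is homeomorphic to $F\times[0,1]/\big((x,0)\sim(\psi(x),1)\big)$ for some surface $F$ (possibly non-compact) and some orientation-preserving homeomorphism $\psi:F\to F$. $M$ is virtually fibered if some finite-sheeted cover of $M$ is fibered (this includes the case that $M$ itself is fibered). Two-bridge (rational) knots and links: identify the sphere with four marked points with the pillowcase $\mathbb{R}^2/\Lambda$, where $\Lambda$ is the group generated by the rotations by $\pi$ about the points of $\mathbb{Z}^2$; the four marked points are the images of $\mathbb{Z}^2$, and for $p/q\in\mathbb{Q}\cup\{\infty\}$ in lowest terms (with $\infty=1/0$) the arcs of slope $p/q$ are the images of the lines of slope $p/q$ through points of $\mathbb{Z}^2$ (there are two such arcs, each joining two marked points). Let $B$ and $B'$ be two balls whose boundaries are each identified with this four-marked sphere, each containing two disjoint properly embedded standard "vertical" arcs with endpoints the four marked points, simultaneously parallel (through disjoint disks) to the two arcs of slope $\infty$ on the boundary. Let $h_{p/q}:\partial B\to\partial B'$ be a homeomorphism preserving the set of marked points, linear in the pillowcase coordinates, taking the arcs of slope $\infty$ on $\partial B$ to the arcs of slope $p/q$ on $\partial B'$. Then $\mathbf{k}_{p/q}$ is the union of the marked arcs in the three-sphere $S^3=B\cup_{h_{p/q}}B'$.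 The two-bridge knots and links are the $\mathbf{k}_{p/q}$ with $\gcd(p,q)=1$; $\mathbf{k}_{p/q}$ is a knot if $q$ is odd and a two-component link if $q$ is even. The case $p/q=1/0=\infty$ is the trivial two-component link, and "non-trivial" means that this case is excluded. *)

theory Defs
  imports "HOL-Complex_Analysis.Complex_Analysis"
begin

section \<open>Quotient spaces\<close>

definition quotient_topology :: "'a topology \<Rightarrow> ('a \<times> 'a) set \<Rightarrow> 'a set topology" where
  "quotient_topology X r =
     topology (\<lambda>U. U \<subseteq> topspace X // r \<and> openin X (\<Union>U))"

text \<open>The space obtained from \<open>X\<close> by the identifications in \<open>R\<close>: the quotient by
  the equivalence relation on \<open>topspace X\<close> generated by \<open>R\<close>.\<close>

definition glue_equiv :: "'a topology \<Rightarrow> ('a \<times> 'a) set \<Rightarrow> ('a \<times> 'a) set" where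
  "glue_equiv X R = Restr ((R \<union> R\<inverse>)\<^sup>*) (topspace X)"

definition glue_space :: "'a topology \<Rightarrow> ('a \<times> 'a) set \<Rightarrow> 'a set topology" where
  "glue_space X R = quotient_topology X (glue_equiv X R)"

lemma equiv_glue_equiv: "equiv (topspace X) (glue_equiv X R)"
proof (rule equivI)
  have "sym ((R \<union> R\<inverse>)\<^sup>*)"
    by (rule sym_rtrancl) (auto simp: sym_def)
  then show "sym (glue_equiv X R)"
    unfolding glue_equiv_def sym_def by blast
  show "trans (glue_equiv X R)"
    unfolding glue_equiv_def trans_def by (auto intro: rtrancl_trans)
qed (auto simp: glue_equiv_def refl_on_def)

lemma openin_quotient_topology:
  assumes "equiv (topspace X) r"
  shows "openin (quotient_topology X r) U \<longleftrightarrow> U \<subseteq> topspace X // r \<and> openin X (\<Union>U)"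
proof -
  have "istopology (\<lambda>U. U \<subseteq> topspace X // r \<and> openin X (\<Union>U))"
    unfolding istopology_def
  proof (intro conjI allI impI)
    fix S T
    assume S: "S \<subseteq> topspace X // r \<and> openin X (\<Union>S)"
      and T: "T \<subseteq> topspace X // r \<and> openin X (\<Union>T)"
    have "\<Union>(S \<inter> T) = \<Union>S \<inter> \<Union>T"
    proof
      show "\<Union>S \<inter> \<Union>T \<subseteq> \<Union>(S \<inter> T)"
      proof
        fix x assume "x \<in> \<Union>S \<inter> \<Union>T"
        then obtain A B where "A \<in> S" "B \<in> T" "x \<in> A" "x \<in> B" by blast
        then have "A = B"
          using quotient_disj[OF assms, of A B] S T by blast
        then show "x \<in> \<Union>(S \<inter> T)" using \<open>A \<in> S\<close> \<open>B \<in> T\<close> \<open>x \<in> A\<close> by blast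
      qed
    qed blast
    then show "openin X (\<Union>(S \<inter> T))" using S T by auto
    show "S \<inter> T \<subseteq> topspace X // r" using S by blast
  next
    fix K assume K: "\<forall>S\<in>K. S \<subseteq> topspace X // r \<and> openin X (\<Union>S)"
    then show "\<Union>K \<subseteq> topspace X // r" by blast
    have "\<Union>(\<Union>K) = \<Union>(Union ` K)" by blast
    then show "openin X (\<Union>(\<Union>K))" using K by auto
  qed
  then show ?thesis
    by (simp add: quotient_topology_def)
qed

lemma quotient_map_quotient_topology:
  assumes "equiv (topspace X) r"
  shows "quotient_map X (quotient_topology X r) (\<lambda>x. r `` {x})"
proof -
  have un: "\<Union>(topspace X // r) = topspace X"
    by (rule Union_quotient[OF assms])
  have top: "topspace (quotient_topology X r) = topspace X // r"
  proof
    show "topspace (quotient_topology X r) \<subseteq> topspace X // r"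
      using openin_quotient_topology[OF assms] openin_topspace by blast
    have "openin (quotient_topology X r) (topspace X // r)"
      by (simp add: openin_quotient_topology[OF assms] un)
    then show "topspace X // r \<subseteq> topspace (quotient_topology X r)"
      by (rule openin_subset)
  qed
  have pre: "{x \<in> topspace X. r `` {x} \<in> U} = \<Union>U" if U: "U \<subseteq> topspace X // r" for U
  proof
    show "{x \<in> topspace X. r `` {x} \<in> U} \<subseteq> \<Union>U"
      using equiv_class_self[OF assms] by blast
    show "\<Union>U \<subseteq> {x \<in> topspace X. r `` {x} \<in> U}"
    proof
      fix x assume "x \<in> \<Union>U"
      then obtain C where C: "C \<in> U" "x \<in> C" by blast
      with U obtain y where y: "y \<in> topspace X" "C = r `` {y}"
        by (blast elim: quotientE)
      with C have "(y, x) \<in> r" by blast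
      then have "r `` {y} = r `` {x}" "x \<in> topspace X"
        using equiv_class_eq[OF assms] assms by (auto simp: equiv_def)
      with C y show "x \<in> {x \<in> topspace X. r `` {x} \<in> U}" by simp
    qed
  qed
  show ?thesis
    unfolding quotient_map_def top
    by (auto simp: pre openin_quotient_topology[OF assms] quotient_def)
qed


section \<open>Oriented surfaces and fibered spaces\<close>

text \<open>Sense-preserving in terms of local degree: small circles around \<open>z\<close> are mapped
  to loops winding once, counterclockwise, around \<open>f z\<close>. It is only used for
  homeomorphisms \<open>f\<close> between open subsets of the plane.\<close>

definition sense_preserving_on :: "complex set \<Rightarrow> (complex \<Rightarrow> complex) \<Rightarrow> bool" where
  "sense_preserving_on S f \<longleftrightarrow>
     (\<forall>z r. 0 < r \<and> cball z r \<subseteq> S \<longrightarrow> winding_number (f \<circ> circlepath z r) (f z) = 1)"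

text \<open>\<open>A\<close> is an oriented atlas, i.e. a set of charts \<open>(U, \<phi>)\<close> with sense-preserving
  transition maps. Surfaces are connected and without boundary, but not necessarily
  compact.\<close>

definition oriented_surface ::
    "'a topology \<Rightarrow> ('a set \<times> ('a \<Rightarrow> complex)) set \<Rightarrow> bool" where
  "oriented_surface F A \<longleftrightarrow>
     topspace F \<noteq> {} \<and> connected_space F \<and> Hausdorff_space F \<and> second_countable F \<and>
     (\<Union>(U, \<phi>)\<in>A. U) = topspace F \<and>
     (\<forall>(U, \<phi>)\<in>A. openin F U \<and> open (\<phi> ` U) \<and>
        homeomorphic_map (subtopology F U) (top_of_set (\<phi> ` U)) \<phi>) \<and>
     (\<forall>(U, \<phi>)\<in>A. \<forall>(V, \<phi>')\<in>A.
        sense_preserving_on (\<phi> ` (U \<inter> V)) (\<phi>' \<circ> inv_into U \<phi>))"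

definition orientation_preserving ::
    "('a set \<times> ('a \<Rightarrow> complex)) set \<Rightarrow> ('a \<Rightarrow> 'a) \<Rightarrow> bool" where
  "orientation_preserving A \<psi> \<longleftrightarrow>
     (\<forall>(U, \<phi>)\<in>A. \<forall>(V, \<phi>')\<in>A.
        sense_preserving_on (\<phi> ` {x \<in> U. \<psi> x \<in> V}) (\<phi>' \<circ> \<psi> \<circ> inv_into U \<phi>))"

definition mapping_torus :: "'a topology \<Rightarrow> ('a \<Rightarrow> 'a) \<Rightarrow> ('a \<times> real) set topology" where
  "mapping_torus F \<psi> =
     glue_space (prod_topology F (top_of_set {0..1}))
       {((x, 0), (\<psi> x, 1)) | x. x \<in> topspace F}"

text \<open>The fiber \<open>F\<close> is an arbitrary topology (not a subspace topology) on a set of complex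
  numbers. As a surface has the cardinality of the continuum, every surface has a
  homeomorphic copy of this form. The same remark applies to the covering space \<open>N\<close> in
  the definition of virtually fibered spaces below.\<close>

definition fibered :: "'a topology \<Rightarrow> bool" where
  "fibered M \<longleftrightarrow>
     (\<exists>(F :: complex topology) A \<psi>.
        oriented_surface F A \<and> homeomorphic_map F F \<psi> \<and> orientation_preserving A \<psi> \<and>
        M homeomorphic_space mapping_torus F \<psi>)"

text \<open>This is \<^const>\<open>covering_space\<close> for topologies that are not given by the type class.\<close>

definition covering_map :: "'a topology \<Rightarrow> 'b topology \<Rightarrow> ('a \<Rightarrow> 'b) \<Rightarrow> bool" where
  "covering_map N M f \<longleftrightarrow>
     continuous_map N M f \<and> f ` topspace N = topspace M \<and>
     (\<forall>y \<in> topspace M. \<exists>T. y \<in> T \<and> openin M T \<and>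
        (\<exists>\<V>. \<Union>\<V> = {x \<in> topspace N. f x \<in> T} \<and>
             (\<forall>V\<in>\<V>. openin N V) \<and> pairwise disjnt \<V> \<and>
             (\<forall>V\<in>\<V>. homeomorphic_map (subtopology N V) (subtopology M T) f)))"

definition finite_sheeted_covering_map ::
    "'a topology \<Rightarrow> 'b topology \<Rightarrow> ('a \<Rightarrow> 'b) \<Rightarrow> bool" where
  "finite_sheeted_covering_map N M f \<longleftrightarrow>
     covering_map N M f \<and> (\<forall>y \<in> topspace M. finite {x \<in> topspace N. f x = y})"

definition virtually_fibered :: "'a topology \<Rightarrow> bool" where
  "virtually_fibered M \<longleftrightarrow>
     (\<exists>(N :: (complex \<times> complex) topology) f. finite_sheeted_covering_map N M f \<and> fibered N)"


section \<open>The pillowcase\<close>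

definition rotation_pi :: "int \<times> int \<Rightarrow> real \<times> real \<Rightarrow> real \<times> real" where
  "rotation_pi = (\<lambda>(m, n) (x, y). (2 * of_int m - x, 2 * of_int n - y))"

text \<open>The group generated by the \<open>\<pi>\<close>-rotations about the integer points. Inverses need
  not be added since the generators are involutions.\<close>

inductive_set pillow_group :: "(real \<times> real \<Rightarrow> real \<times> real) set" where
  id: "id \<in> pillow_group"
| rotation: "g \<in> pillow_group \<Longrightarrow> rotation_pi c \<circ> g \<in> pillow_group"

text \<open>The pillowcase is realised in space as the boundary of \<open>tangle_ball\<close>, which is
  homeomorphic to a round ball (\<open>tangle_ball_homeomorphic_cball\<close>). The
  fibers of the parametrisation \<open>pillow_map\<close> are exactly the orbits of \<^const>\<open>pillow_group\<close>
  (\<open>pillow_map_eq_iff\<close>), and its image is exactly the boundary of the ball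
  (\<open>range_pillow_map\<close>).\<close>

definition pillow_map :: "real \<times> real \<Rightarrow> real \<times> real \<times> real" where
  "pillow_map = (\<lambda>(x, y). (cos (pi * x), cos (pi * y), sin (pi * x) * sin (pi * y)))"

definition tangle_ball :: "(real \<times> real \<times> real) set" where
  "tangle_ball = {(u, v, w). \<bar>u\<bar> \<le> 1 \<and> \<bar>v\<bar> \<le> 1 \<and> w\<^sup>2 \<le> (1 - u\<^sup>2) * (1 - v\<^sup>2)}"

definition marked_points :: "(real \<times> real \<times> real) set" where
  "marked_points = pillow_map ` (\<int> \<times> \<int>)"

text \<open>The union of the two arcs of slope \<open>p/q\<close>; slope \<open>\<infinity>\<close> is \<open>p = 1\<close>, \<open>q = 0\<close>.\<close>

definition slope_arcs :: "int \<Rightarrow> int \<Rightarrow> (real \<times> real \<times> real) set" where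
  "slope_arcs p q =
     pillow_map ` {(of_int m + t * of_int q, of_int n + t * of_int p) | (m::int) (n::int) t. True}"

text \<open>The arcs of slope \<open>\<infinity>\<close> are the two segments \<open>u = 1\<close> and \<open>u = -1\<close> of the
  boundary (with \<open>w = 0\<close>). The two vertical arcs are obtained from them by pushing their
  interiors into the interior of the ball, across the two disjoint disks
  \<open>w = 0\<close>, \<open>(1 + v\<^sup>2) / 2 \<le> \<bar>u\<bar> \<le> 1\<close>.\<close>

definition vertical_arcs :: "(real \<times> real \<times> real) set" where
  "vertical_arcs = {(u, v, w). \<bar>v\<bar> \<le> 1 \<and> w = 0 \<and> \<bar>u\<bar> = (1 + v\<^sup>2) / 2}"


section \<open>Two-bridge knots and links\<close>

text \<open>The map \<open>h\<close> is not determined by \<open>p/q\<close>; any map with these properties is allowed.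
  For coprime \<open>p\<close> and \<open>q\<close> there is one (\<open>two_bridge_gluing_exists\<close>).\<close>

definition two_bridge_gluing ::
    "int \<Rightarrow> int \<Rightarrow> (real \<times> real \<times> real \<Rightarrow> real \<times> real \<times> real) \<Rightarrow> bool" where
  "two_bridge_gluing p q h \<longleftrightarrow>
     homeomorphic_map (top_of_set (frontier tangle_ball)) (top_of_set (frontier tangle_ball)) h \<and>
     h ` marked_points = marked_points \<and>
     (\<exists>L. linear L \<and> (\<forall>z. h (pillow_map z) = pillow_map (L z))) \<and>
     h ` slope_arcs 1 0 = slope_arcs p q"

text \<open>The ball \<open>B\<close> is the copy of \<^const>\<open>tangle_ball\<close> with index \<^const>\<open>False\<close>, and \<open>B'\<close> the copy
  with index \<^const>\<open>True\<close>.\<close>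

definition two_balls :: "(bool \<times> real \<times> real \<times> real) topology" where
  "two_balls = sum_topology (\<lambda>_. top_of_set tangle_ball) UNIV"

definition gluing_rel ::
    "(real \<times> real \<times> real \<Rightarrow> real \<times> real \<times> real)
      \<Rightarrow> ((bool \<times> real \<times> real \<times> real) \<times> (bool \<times> real \<times> real \<times> real)) set" where
  "gluing_rel h = {((False, x), (True, h x)) | x. x \<in> frontier tangle_ball}"

definition glued_sphere ::
    "(real \<times> real \<times> real \<Rightarrow> real \<times> real \<times> real) \<Rightarrow> (bool \<times> real \<times> real \<times> real) set topology"
  where "glued_sphere h = glue_space two_balls (gluing_rel h)"

definition two_bridge_link ::
    "(real \<times> real \<times> real \<Rightarrow> real \<times> real \<times> real) \<Rightarrow> (bool \<times> real \<times> real \<times> real) set set" where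
  "two_bridge_link h =
     (\<lambda>x. glue_equiv two_balls (gluing_rel h) `` {x}) ` (UNIV \<times> vertical_arcs)"

definition two_bridge_complement ::
    "(real \<times> real \<times> real \<Rightarrow> real \<times> real \<times> real) \<Rightarrow> (bool \<times> real \<times> real \<times> real) set topology"
  where "two_bridge_complement h =
     subtopology (glued_sphere h) (topspace (glued_sphere h) - two_bridge_link h)"


section \<open>The model is a pillowcase bounding a ball, and gluing maps exist\<close>

lemma pillow_group_iff:
  "(\<exists>g\<in>pillow_group. z' = g z) \<longleftrightarrow>
     (\<exists>m n :: int. z' = (fst z + 2 * of_int m, snd z + 2 * of_int n) \<or>
                   z' = (2 * of_int m - fst z, 2 * of_int n - snd z))" (is "?L \<longleftrightarrow> ?R")
proof
  assume ?L
  then obtain g where "g \<in> pillow_group" "z' = g z" by blast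
  then show ?R
  proof (induction g arbitrary: z')
    case id
    then show ?case by (intro exI[of _ 0]) auto
  next
    case (rotation g c)
    obtain a b where c: "c = (a, b)" by (cases c)
    obtain m n :: int where
      mn: "g z = (fst z + 2 * of_int m, snd z + 2 * of_int n) \<or>
           g z = (2 * of_int m - fst z, 2 * of_int n - snd z)"
      using rotation.IH by blast
    have "z' = (2 * of_int (a - m) - fst z, 2 * of_int (b - n) - snd z) \<or>
          z' = (fst z + 2 * of_int (a - m), snd z + 2 * of_int (b - n))"
      using mn rotation.prems c by (auto simp: rotation_pi_def)
    then show ?case by blast
  qed
next
  assume ?R
  then obtain m n :: int where
    mn: "z' = (fst z + 2 * of_int m, snd z + 2 * of_int n) \<or>
         z' = (2 * of_int m - fst z, 2 * of_int n - snd z)" by blast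
  have r: "rotation_pi (m, n) \<circ> id \<in> pillow_group" for m n
    by (intro pillow_group.intros)
  have t: "rotation_pi (m, n) \<circ> (rotation_pi (0, 0) \<circ> id) \<in> pillow_group"
    by (intro pillow_group.intros)
  from mn show ?L
  proof
    assume "z' = (fst z + 2 * of_int m, snd z + 2 * of_int n)"
    then have "z' = (rotation_pi (m, n) \<circ> (rotation_pi (0, 0) \<circ> id)) z"
      by (cases z) (simp add: rotation_pi_def)
    with t show ?L by blast
  next
    assume "z' = (2 * of_int m - fst z, 2 * of_int n - snd z)"
    then have "z' = (rotation_pi (m, n) \<circ> id) z"
      by (cases z) (simp add: rotation_pi_def)
    with r show ?L by blast
  qed
qed

lemma cos_pi_eq_iff:
  "cos (pi * x) = cos (pi * y) \<longleftrightarrow> (\<exists>m::int. y = x + 2 * of_int m \<or> y = 2 * of_int m - x)"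
proof
  assume "cos (pi * x) = cos (pi * y)"
  then obtain n where n: "n \<in> \<int>" "pi * x = pi * y + 2 * n * pi \<or> pi * x = - (pi * y) + 2 * n * pi"
    using cos_eq by metis
  then obtain k where k: "n = of_int k" by (auto elim: Ints_cases)
  have "pi * x = pi * (y + 2 * n) \<or> pi * x = pi * (2 * n - y)"
    using n(2) by (simp add: algebra_simps)
  then have "x = y + 2 * n \<or> x = 2 * n - y"
    using mult_left_cancel[OF pi_neq_zero] by blast
  then have "y = x + 2 * of_int (-k) \<or> y = 2 * of_int k - x"
    using k by auto
  then show "\<exists>m::int. y = x + 2 * of_int m \<or> y = 2 * of_int m - x" by blast
next
  assume "\<exists>m::int. y = x + 2 * of_int m \<or> y = 2 * of_int m - x"
  then obtain m :: int where "y = x + 2 * of_int m \<or> y = 2 * of_int m - x" by blast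
  then have "pi * y = pi * x + of_int m * (2 * pi) \<or> pi * y = - (pi * x) + of_int m * (2 * pi)"
  proof (elim disjE)
    assume y: "y = x + 2 * of_int m"
    have "pi * y = pi * x + of_int m * (2 * pi)" unfolding y by (simp add: algebra_simps)
    then show ?thesis ..
  next
    assume y: "y = 2 * of_int m - x"
    have "pi * y = - (pi * x) + of_int m * (2 * pi)" unfolding y by (simp add: algebra_simps)
    then show ?thesis ..
  qed
  then show "cos (pi * x) = cos (pi * y)"
    by (auto simp: cos_add cos_diff cos_int_2pin sin_int_2pin mult.commute[of "of_int m"])
qed

lemma sin_pi_shift:
  "sin (pi * (x + 2 * of_int m)) = sin (pi * x)" "sin (pi * (2 * of_int m - x)) = - sin (pi * x)"
proof -
  have *: "pi * (x + 2 * of_int m) = pi * x + 2 * pi * of_int m"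
    "pi * (2 * of_int m - x) = - (pi * x) + 2 * pi * of_int m"
    by (auto simp: algebra_simps)
  show "sin (pi * (x + 2 * of_int m)) = sin (pi * x)" "sin (pi * (2 * of_int m - x)) = - sin (pi * x)"
    unfolding * by (simp_all add: sin_add sin_diff cos_int_2pin sin_int_2pin)
qed

lemma sin_pi_eq_0: "sin (pi * x) = 0 \<Longrightarrow> \<exists>m::int. x = of_int m"
proof -
  assume "sin (pi * x) = 0"
  then obtain i :: int where "pi * x = of_int i * pi" by (auto simp: sin_zero_iff_int2)
  then have "x = of_int i" by simp
  then show ?thesis by blast
qed

lemma pillow_map_eq_iff:
  "pillow_map z = pillow_map z' \<longleftrightarrow> (\<exists>g\<in>pillow_group. z' = g z)"
  unfolding pillow_group_iff
proof -
  obtain x y x' y' where z: "z = (x, y)" "z' = (x', y')" by (cases z, cases z')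
  let ?R = "\<exists>m n :: int. z' = (fst z + 2 * of_int m, snd z + 2 * of_int n) \<or>
                   z' = (2 * of_int m - fst z, 2 * of_int n - snd z)"
  have 1: "?R" if "pillow_map z = pillow_map z'"
  proof -
    from that have cx: "cos (pi * x) = cos (pi * x')" and cy: "cos (pi * y) = cos (pi * y')"
      and s: "sin (pi * x) * sin (pi * y) = sin (pi * x') * sin (pi * y')"
      by (auto simp: z pillow_map_def)
    obtain m :: int where m: "x' = x + 2 * of_int m \<or> x' = 2 * of_int m - x"
      using cx by (auto simp: cos_pi_eq_iff)
    obtain n :: int where n: "y' = y + 2 * of_int n \<or> y' = 2 * of_int n - y"
      using cy by (auto simp: cos_pi_eq_iff)
    have int_case: "?R" if "x' = x + 2 * of_int m \<and> y' = 2 * of_int n - y \<or>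
                           x' = 2 * of_int m - x \<and> y' = y + 2 * of_int n"
    proof -
      have "sin (pi * x) * sin (pi * y) = 0"
        using s that by (auto simp: sin_pi_shift)
      then consider k :: int where "x = of_int k" | k :: int where "y = of_int k"
        using sin_pi_eq_0 by (metis mult_eq_0_iff)
      then show ?R
      proof cases
        case 1
        then have "z' = (2 * of_int (m + k) - fst z, 2 * of_int n - snd z) \<or>
                   z' = (fst z + 2 * of_int (m - k), snd z + 2 * of_int n)"
          using that by (auto simp: z)
        then show ?R by blast
      next
        case 2
        then have "z' = (fst z + 2 * of_int m, snd z + 2 * of_int (n - k)) \<or>
                   z' = (2 * of_int m - fst z, 2 * of_int (n + k) - snd z)"
          using that by (auto simp: z)
        then show ?R by blast
      qed
    qed
    show ?R
      using m n int_case by (auto simp: z)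
  qed
  have 2: "pillow_map z = pillow_map z'" if "?R"
  proof -
    from that obtain m n :: int where "x' = x + 2 * of_int m \<and> y' = y + 2 * of_int n \<or>
     x' = 2 * of_int m - x \<and> y' = 2 * of_int n - y"
    by (auto simp: z)
  then have c: "cos (pi * x) = cos (pi * x') \<and> cos (pi * y) = cos (pi * y') \<and> 
     sin (pi * x) * sin (pi * y) = sin (pi * x') * sin (pi * y')"
    by (auto simp: cos_pi_eq_iff sin_pi_shift)
  then show "pillow_map z = pillow_map z'"
    by (simp add: z pillow_map_def)
  qed
  from 1 2 show "pillow_map z = pillow_map z' \<longleftrightarrow> ?R" by blast
qed

lemma compact_tangle_ball: "compact tangle_ball"
proof -
  have "closed tangle_ball"
    unfolding tangle_ball_def case_prod_unfold
    by (intro closed_Collect_conj closed_Collect_le continuous_intros)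
  moreover have "tangle_ball \<subseteq> {-1..1} \<times> {-1..1} \<times> {-1..1}"
  proof
    fix z assume "z \<in> tangle_ball"
    then obtain u v w where z: "z = (u, v, w)" and *: "(u, v, w) \<in> tangle_ball"
      by (cases z) auto
    then have "w\<^sup>2 \<le> (1 - u\<^sup>2) * (1 - v\<^sup>2)" "u\<^sup>2 \<le> 1" "v\<^sup>2 \<le> 1"
      by (auto simp: tangle_ball_def abs_square_le_1)
    moreover have "(1 - u\<^sup>2) * (1 - v\<^sup>2) \<le> 1 * 1"
      using calculation by (intro mult_mono) auto
    ultimately have "w\<^sup>2 \<le> 1" by simp
    then have "\<bar>w\<bar> \<le> 1" by (simp add: abs_square_le_1)
    with * show "z \<in> {-1..1} \<times> {-1..1} \<times> {-1..1}"
      by (auto simp: z tangle_ball_def)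
  qed
  moreover have "bounded ({-1..1} \<times> {-1..1} \<times> {-1..1} :: (real \<times> real \<times> real) set)"
    by (intro bounded_Times) auto
  ultimately show ?thesis
    using bounded_subset compact_eq_bounded_closed by blast
qed

lemma interior_tangle_ball:
  "interior tangle_ball = {(u, v, w). \<bar>u\<bar> < 1 \<and> \<bar>v\<bar> < 1 \<and> w\<^sup>2 < (1 - u\<^sup>2) * (1 - v\<^sup>2)}"
    (is "_ = ?I")
proof
  have "open ?I"
    unfolding case_prod_unfold
    by (intro open_Collect_conj open_Collect_less continuous_intros)
  then show "?I \<subseteq> interior tangle_ball"
    by (intro interior_maximal) (auto simp: tangle_ball_def)
next
  show "interior tangle_ball \<subseteq> ?I"
  proof clarify
    fix u v w assume "(u, v, w) \<in> interior tangle_ball"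
    then obtain e where e: "e > 0" "ball (u, v, w) e \<subseteq> tangle_ball"
      by (auto simp: mem_interior)
    define s where "s = 1 + e / (2 * (norm (u, v, w) + 1))"
    have n: "norm (u, v, w) + 1 > 0"
      using norm_ge_zero[of "(u, v, w)"] by linarith
    have s: "s > 1" using e n by (simp add: s_def)
    have "dist (u, v, w) (s *\<^sub>R (u, v, w)) = norm ((s - 1) *\<^sub>R (u, v, w))"
      by (metis dist_commute dist_norm scaleR_left_diff_distrib scaleR_one)
    also have "\<dots> = (s - 1) * norm (u, v, w)" using s by (simp only: norm_scaleR)
    also have "\<dots> = e * (norm (u, v, w) / (2 * (norm (u, v, w) + 1)))" by (simp add: s_def)
    also have "\<dots> < e * 1"
    proof (rule mult_strict_left_mono)
      have "N / (2 * (N + 1)) < 1" if "N \<ge> 0" for N :: real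
        using that by (simp add: field_simps)
      then show "norm (u, v, w) / (2 * (norm (u, v, w) + 1)) < 1"
        using norm_ge_zero by blast
    qed (use e in auto)
    finally have "s *\<^sub>R (u, v, w) \<in> tangle_ball"
      using e by auto
    then have b: "\<bar>s * u\<bar> \<le> 1" "\<bar>s * v\<bar> \<le> 1" "(s * w)\<^sup>2 \<le> (1 - (s * u)\<^sup>2) * (1 - (s * v)\<^sup>2)"
      by (auto simp: tangle_ball_def)
    have lt: "\<bar>x\<bar> < 1" if "\<bar>s * x\<bar> \<le> 1" for x
    proof (cases "x = 0")
      case False
      then have "\<bar>x\<bar> < s * \<bar>x\<bar>" using s by simp
      with that s show ?thesis by (simp add: abs_mult)
    qed auto
    have uv: "\<bar>u\<bar> < 1" "\<bar>v\<bar> < 1" using b lt by blast+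
    have mono: "x\<^sup>2 \<le> (s * x)\<^sup>2" for x
    proof -
      have "1 * x\<^sup>2 \<le> s\<^sup>2 * x\<^sup>2"
        using s by (intro mult_right_mono) auto
      then show ?thesis by (simp add: power_mult_distrib)
    qed
    have "w\<^sup>2 < (1 - u\<^sup>2) * (1 - v\<^sup>2)"
    proof (cases "w = 0")
      case True
      then show ?thesis using uv by (simp add: abs_square_less_1)
    next
      case False
      have "w\<^sup>2 < s\<^sup>2 * w\<^sup>2" using s False by simp
      also have "\<dots> \<le> (1 - (s * u)\<^sup>2) * (1 - (s * v)\<^sup>2)"
        using b by (simp add: power_mult_distrib)
      also have "\<dots> \<le> (1 - u\<^sup>2) * (1 - v\<^sup>2)"
        using mono[of u] mono[of v] b(1,2) uv
        by (intro mult_mono) (auto simp: abs_square_le_1 abs_square_less_1 less_imp_le)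
      finally show ?thesis .
    qed
    with uv show "\<bar>u\<bar> < 1 \<and> \<bar>v\<bar> < 1 \<and> w\<^sup>2 < (1 - u\<^sup>2) * (1 - v\<^sup>2)" by blast
  qed
qed

lemma frontier_tangle_ball:
  "frontier tangle_ball = {(u, v, w). \<bar>u\<bar> \<le> 1 \<and> \<bar>v\<bar> \<le> 1 \<and> w\<^sup>2 = (1 - u\<^sup>2) * (1 - v\<^sup>2)}"
proof -
  have "frontier tangle_ball = tangle_ball - interior tangle_ball"
    using compact_tangle_ball by (simp add: frontier_def compact_imp_closed)
  also have "\<dots> = {(u, v, w). \<bar>u\<bar> \<le> 1 \<and> \<bar>v\<bar> \<le> 1 \<and> w\<^sup>2 = (1 - u\<^sup>2) * (1 - v\<^sup>2)}"
  proof -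
    have sq: "u\<^sup>2 = 1" if "\<bar>u\<bar> \<le> 1" "\<not> \<bar>u\<bar> < 1" for u :: real
      using that by (metis less_eq_real_def one_power2 power2_abs)
    have "(u, v, w) \<in> tangle_ball \<and>
            \<not> (\<bar>u\<bar> < 1 \<and> \<bar>v\<bar> < 1 \<and> w\<^sup>2 < (1 - u\<^sup>2) * (1 - v\<^sup>2)) \<longleftrightarrow>
          \<bar>u\<bar> \<le> 1 \<and> \<bar>v\<bar> \<le> 1 \<and> w\<^sup>2 = (1 - u\<^sup>2) * (1 - v\<^sup>2)" for u v w
    proof (cases "\<bar>u\<bar> \<le> 1 \<and> \<bar>v\<bar> \<le> 1")
      case b: True
      show ?thesis
      proof (cases "\<bar>u\<bar> < 1 \<and> \<bar>v\<bar> < 1")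
        case True
        with b show ?thesis by (simp add: tangle_ball_def) linarith
      next
        case False
        with b sq[of u] sq[of v] have 0: "(1 - u\<^sup>2) * (1 - v\<^sup>2) = 0" by auto
        show ?thesis
          unfolding tangle_ball_def mem_Collect_eq case_prod_conv 0 using b False by auto
      qed
    qed (auto simp: tangle_ball_def)
    then show ?thesis
      unfolding interior_tangle_ball by (auto simp only: set_eq_iff Diff_iff mem_Collect_eq case_prod_conv split_paired_All)
  qed
  finally show ?thesis .
qed

lemma range_pillow_map:
  "pillow_map ` ({-1..1} \<times> {-1..1}) = frontier tangle_ball"
  "range pillow_map = frontier tangle_ball"
proof -
  have 1: "range pillow_map \<subseteq> frontier tangle_ball"
    by (auto simp: frontier_tangle_ball pillow_map_def power_mult_distrib sin_squared_eq)
  have 2: "frontier tangle_ball \<subseteq> pillow_map ` ({-1..1} \<times> {-1..1})"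
  proof clarify
    fix u v w assume "(u, v, w) \<in> frontier tangle_ball"
    then have uv: "\<bar>u\<bar> \<le> 1" "\<bar>v\<bar> \<le> 1" and w: "w\<^sup>2 = (1 - u\<^sup>2) * (1 - v\<^sup>2)"
      by (auto simp: frontier_tangle_ball)
    define x where "x = arccos u / pi"
    define y where "y = arccos v / pi"
    have b: "0 \<le> x" "x \<le> 1" "0 \<le> y" "y \<le> 1"
      using uv by (auto simp: x_def y_def arccos_lbound arccos_ubound)
    have c: "cos (pi * x) = u" "cos (pi * y) = v"
      using uv by (auto simp: x_def y_def cos_arccos_abs)
    have "w\<^sup>2 = (sin (pi * x) * sin (pi * y))\<^sup>2"
      by (simp add: w power_mult_distrib sin_squared_eq c)
    then consider "w = sin (pi * x) * sin (pi * y)" | "w = sin (pi * x) * sin (pi * (- y))"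
      by (auto simp: power2_eq_iff)
    then show "(u, v, w) \<in> pillow_map ` ({-1..1} \<times> {-1..1})"
    proof cases
      case 1
      then show ?thesis
        using b c by (intro image_eqI[of _ _ "(x, y)"]) (auto simp: pillow_map_def)
    next
      case 2
      then show ?thesis
        using b c by (intro image_eqI[of _ _ "(x, - y)"]) (auto simp: pillow_map_def)
    qed
  qed
  from 1 2 show "pillow_map ` ({-1..1} \<times> {-1..1}) = frontier tangle_ball"
    "range pillow_map = frontier tangle_ball"
    by blast+
qed

lemma tangle_ball_homeomorphic_cball:
  "tangle_ball homeomorphic cball (0 :: real \<times> real \<times> real) 1"
proof (rule starlike_compact_projective_special[OF compact_tangle_ball])
  show "cball 0 1 \<subseteq> tangle_ball"
  proof clarify
    fix u v w :: real assume "(u, v, w) \<in> cball 0 1"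
    then have *: "u\<^sup>2 + (v\<^sup>2 + w\<^sup>2) \<le> 1"
      by (simp add: norm_prod_def)
    have "u\<^sup>2 \<le> 1" "v\<^sup>2 \<le> 1" "0 \<le> u\<^sup>2 * v\<^sup>2"
      using * zero_le_power2[of u] zero_le_power2[of v] zero_le_power2[of w]
      by (linarith, linarith, simp)
    then have "w\<^sup>2 \<le> (1 - u\<^sup>2) * (1 - v\<^sup>2)"
      using * unfolding left_diff_distrib right_diff_distrib by linarith
    with \<open>u\<^sup>2 \<le> 1\<close> \<open>v\<^sup>2 \<le> 1\<close> show "(u, v, w) \<in> tangle_ball"
      by (simp add: tangle_ball_def abs_square_le_1)
  qed
next
  fix x and s :: real
  assume "x \<in> tangle_ball" and s: "0 \<le> s" "s < 1"
  then obtain u v w where x: "x = (u, v, w)"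
    and b: "u\<^sup>2 \<le> 1" "v\<^sup>2 \<le> 1" "w\<^sup>2 \<le> (1 - u\<^sup>2) * (1 - v\<^sup>2)"
    by (cases x) (auto simp: tangle_ball_def abs_square_le_1)
  have s2: "0 \<le> s\<^sup>2" "s\<^sup>2 < 1" using s by (auto simp: abs_square_less_1)
  have lt: "(s * a)\<^sup>2 < 1" "(s * a)\<^sup>2 \<le> a\<^sup>2" if "a\<^sup>2 \<le> 1" for a
  proof -
    have "s\<^sup>2 * a\<^sup>2 \<le> s\<^sup>2 * 1" using that s2 by (intro mult_left_mono) auto
    with s2 show "(s * a)\<^sup>2 < 1" by (simp add: power_mult_distrib)
    have "s\<^sup>2 * a\<^sup>2 \<le> 1 * a\<^sup>2" using s2 by (intro mult_right_mono) auto
    then show "(s * a)\<^sup>2 \<le> a\<^sup>2" by (simp add: power_mult_distrib)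
  qed
  have "(s * w)\<^sup>2 < (1 - (s * u)\<^sup>2) * (1 - (s * v)\<^sup>2)"
  proof (cases "w = 0")
    case True
    then show ?thesis using lt(1)[OF b(1)] lt(1)[OF b(2)] by simp
  next
    case False
    then have "(s * w)\<^sup>2 < w\<^sup>2" using s2 by (simp add: power_mult_distrib)
    also have "\<dots> \<le> (1 - u\<^sup>2) * (1 - v\<^sup>2)" by fact
    also have "\<dots> \<le> (1 - (s * u)\<^sup>2) * (1 - (s * v)\<^sup>2)"
      using lt[OF b(1)] lt[OF b(2)] b by (intro mult_mono) auto
    finally show ?thesis .
  qed
  then have "s *\<^sub>R x \<in> interior tangle_ball"
    using lt(1)[OF b(1)] lt(1)[OF b(2)]
    by (simp add: x interior_tangle_ball abs_square_less_1)
  then show "s *\<^sub>R x \<in> tangle_ball - frontier tangle_ball"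
    using interior_subset by (auto simp: frontier_def)
qed

lemma quotient_map_pillow_map:
  "quotient_map (top_of_set ({-1..1} \<times> {-1..1})) (top_of_set (frontier tangle_ball)) pillow_map"
proof -
  have c: "continuous_on ({-1..1} \<times> {-1..1}) pillow_map"
    unfolding pillow_map_def case_prod_unfold by (intro continuous_intros)
  have "compact ({-1..1} \<times> {-1..1} :: (real \<times> real) set)"
    by (intro compact_Times) auto
  then have "compact_space (top_of_set ({-1..1} \<times> {-1..1} :: (real \<times> real) set))"
    by (simp add: compact_space_subtopology)
  moreover have "Hausdorff_space (top_of_set (frontier tangle_ball))"
    by (simp add: Hausdorff_space_subtopology)
  moreover have "continuous_map (top_of_set ({-1..1} \<times> {-1..1})) (top_of_set (frontier tangle_ball)) pillow_map"
    using c range_pillow_map(1) by (auto simp: continuous_map_in_subtopology)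
  ultimately show ?thesis
    using range_pillow_map(1) by (intro continuous_imp_quotient_map) auto
qed

text \<open>Unimodular integer matrices act on the pillowcase.\<close>

lemma pillow_map_unimodular:
  fixes a b c d :: int
  assumes "pillow_map z = pillow_map z'"
  defines "L \<equiv> \<lambda>(x, y). (of_int a * x + of_int b * y, of_int c * x + of_int d * y) :: real \<times> real"
  shows "pillow_map (L z) = pillow_map (L z')"
proof -
  obtain m n :: int where "z' = (fst z + 2 * of_int m, snd z + 2 * of_int n) \<or>
                           z' = (2 * of_int m - fst z, 2 * of_int n - snd z)"
    using assms(1) pillow_map_eq_iff pillow_group_iff by metis
  then have "L z' = (fst (L z) + 2 * of_int (a * m + b * n), snd (L z) + 2 * of_int (c * m + d * n)) \<or>
             L z' = (2 * of_int (a * m + b * n) - fst (L z), 2 * of_int (c * m + d * n) - snd (L z))"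
    by (elim disjE) (simp_all add: L_def case_prod_unfold algebra_simps)
  then show ?thesis
    unfolding pillow_map_eq_iff pillow_group_iff by blast
qed

lemma two_bridge_gluing_exists:
  assumes "coprime p q"
  shows "\<exists>h. two_bridge_gluing p q h"
proof -
  obtain a c where "a * p + c * q = 1"
    using assms bezout_int[of p q] by (auto simp: coprime_iff_gcd_eq_1)
  define c' where "c' = - c"
  have det: "a * p - q * c' = 1"
    using \<open>a * p + c * q = 1\<close> by (simp add: c'_def mult.commute)
  have detr: "of_int a * of_int p - of_int q * of_int c' = (1::real)"
    using det by (metis of_int_1 of_int_diff of_int_mult)
  define L :: "real \<times> real \<Rightarrow> real \<times> real" where
    "L = (\<lambda>(x, y). (of_int a * x + of_int q * y, of_int c' * x + of_int p * y))"
  define L' :: "real \<times> real \<Rightarrow> real \<times> real" where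
    "L' = (\<lambda>(x, y). (of_int p * x + of_int (- q) * y, of_int (- c') * x + of_int a * y))"
  have LL': "L (L' z) = z" and L'L: "L' (L z) = z" for z
  proof -
    obtain x y where z: "z = (x, y)" by (cases z)
    have 1: "x = x * (of_int a * of_int p - of_int q * of_int c')"
      "y = y * (of_int a * of_int p - of_int q * of_int c')" by (simp_all add: detr)
    have "L (L' z) = (x * (of_int a * of_int p - of_int q * of_int c'), y * (of_int a * of_int p - of_int q * of_int c'))"
      by (simp add: L_def L'_def z algebra_simps)
    then show "L (L' z) = z" using 1 z by simp
    have "L' (L z) = (x * (of_int a * of_int p - of_int q * of_int c'), y * (of_int a * of_int p - of_int q * of_int c'))"
      by (simp add: L_def L'_def z algebra_simps)
    then show "L' (L z) = z" using 1 z by simp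
  qed
  define H where "H = (\<lambda>K w. pillow_map (K (SOME x. pillow_map x = w)) :: real \<times> real \<times> real)"
  have H: "H K (pillow_map z) = pillow_map (K z)"
    if "\<And>z z'. pillow_map z = pillow_map z' \<Longrightarrow> pillow_map (K z) = pillow_map (K z')" for K z
    unfolding H_def by (rule that) (rule someI[of _ z], simp)
  have HL: "H L (pillow_map z) = pillow_map (L z)" for z
    by (rule H) (unfold L_def, rule pillow_map_unimodular)
  have HL': "H L' (pillow_map z) = pillow_map (L' z)" for z
    by (rule H) (unfold L'_def, rule pillow_map_unimodular)
  have cont: "continuous_map (top_of_set (frontier tangle_ball)) (top_of_set (frontier tangle_ball)) g"
    if g: "\<And>z. g (pillow_map z) = pillow_map (K z)" and K: "continuous_on UNIV K" for g K
  proof (rule continuous_compose_quotient_map[OF quotient_map_pillow_map])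
    have "g \<circ> pillow_map = pillow_map \<circ> K" using g by auto
    moreover have "continuous_on UNIV pillow_map"
      unfolding pillow_map_def case_prod_unfold by (intro continuous_intros)
    ultimately have "continuous_on UNIV (g \<circ> pillow_map)"
      using K by (metis continuous_on_compose continuous_on_subset subset_UNIV)
    then have "continuous_on ({-1..1} \<times> {-1..1}) (g \<circ> pillow_map)"
      by (rule continuous_on_subset) simp
    moreover have "(g \<circ> pillow_map) ` ({-1..1} \<times> {-1..1}) \<subseteq> frontier tangle_ball"
      using g range_pillow_map(2) by auto
    ultimately show "continuous_map (top_of_set ({-1..1} \<times> {-1..1})) (top_of_set (frontier tangle_ball)) (g \<circ> pillow_map)"
      by (auto simp: continuous_map_subtopology_eu continuous_map_in_subtopology)
  qed
  have lin: "linear L"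
    unfolding L_def by (rule linearI) (auto simp: algebra_simps)
  have "homeomorphic_maps (top_of_set (frontier tangle_ball)) (top_of_set (frontier tangle_ball)) (H L) (H L')"
    unfolding homeomorphic_maps_def
  proof (intro conjI ballI)
    show "continuous_map (top_of_set (frontier tangle_ball)) (top_of_set (frontier tangle_ball)) (H L)"
      by (rule cont[of "H L" L, OF HL]) (unfold L_def case_prod_unfold, intro continuous_intros)
    show "continuous_map (top_of_set (frontier tangle_ball)) (top_of_set (frontier tangle_ball)) (H L')"
      by (rule cont[of "H L'" L', OF HL']) (unfold L'_def case_prod_unfold, intro continuous_intros)
  next
    fix w assume "w \<in> topspace (top_of_set (frontier tangle_ball))"
    then have "w \<in> range pillow_map" by (simp add: range_pillow_map(2))
    then obtain z where "w = pillow_map z" by blast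
    then show "H L' (H L w) = w" "H L (H L' w) = w"
      by (simp_all add: HL HL' LL' L'L)
  qed
  then have hom: "homeomorphic_map (top_of_set (frontier tangle_ball)) (top_of_set (frontier tangle_ball)) (H L)"
    by (auto simp: homeomorphic_map_maps)
  have img: "H L ` pillow_map ` S = pillow_map ` T" if "L ` S = T" for S T
    using that by (auto simp: HL image_image)
  have LZ: "K (x, y) \<in> \<int> \<times> \<int>" if "x \<in> \<int>" "y \<in> \<int>" "K = L \<or> K = L'" for K x y
    using that by (auto simp: L_def L'_def)
  have "L ` (\<int> \<times> \<int>) = \<int> \<times> \<int>"
  proof
    show "L ` (\<int> \<times> \<int>) \<subseteq> \<int> \<times> \<int>" using LZ[of _ _ L] by blast
    show "\<int> \<times> \<int> \<subseteq> L ` (\<int> \<times> \<int>)"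
    proof
      fix z :: "real \<times> real" assume "z \<in> \<int> \<times> \<int>"
      then have "L' z \<in> \<int> \<times> \<int>" using LZ[of _ _ L'] by blast
      then show "z \<in> L ` (\<int> \<times> \<int>)" using LL'[of z] by (metis image_eqI)
    qed
  qed
  then have marked: "H L ` marked_points = marked_points"
    unfolding marked_points_def by (rule img)
  let ?S = "\<lambda>p q. {(of_int m + t * of_int q, of_int n + t * of_int p) | (m::int) (n::int) t. True} :: (real \<times> real) set"
  have "L ` ?S 1 0 = ?S p q"
  proof
    show "L ` ?S 1 0 \<subseteq> ?S p q"
    proof
      fix w assume "w \<in> L ` ?S 1 0"
      then obtain m n :: int and t :: real
        where w: "w = L (of_int m + t * of_int 0, of_int n + t * of_int 1)"
        by blast
      have "L (of_int m + t * of_int 0, of_int n + t * of_int 1) =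
        (of_int (a * m + q * n) + t * of_int q, of_int (c' * m + p * n) + t * of_int p)"
        by (simp add: L_def algebra_simps)
      then show "w \<in> ?S p q" unfolding w by blast
    qed
    show "?S p q \<subseteq> L ` ?S 1 0"
    proof
      fix w assume "w \<in> ?S p q"
      then obtain m n :: int and t :: real
        where w: "w = (of_int m + t * of_int q, of_int n + t * of_int p)"
        by blast
      let ?z = "(of_int m + t * of_int q, of_int n + t * of_int p)"
      have "L' ?z = (of_int (p * m - q * n), of_int (a * n - c' * m) + t * (of_int a * of_int p - of_int q * of_int c'))"
        by (simp add: L'_def algebra_simps)
      then have "L' ?z = (of_int (p * m - q * n) + t * of_int 0, of_int (a * n - c' * m) + t * of_int 1)"
        by (simp add: detr)
      then have 1: "L' ?z \<in> ?S 1 0" by blast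
      have "w = L (L' ?z)" by (simp only: w LL')
      then show "w \<in> L ` ?S 1 0" using 1 by (rule image_eqI)
    qed
  qed
  then have "H L ` slope_arcs 1 0 = slope_arcs p q"
    unfolding slope_arcs_def by (rule img)
  with hom marked lin HL show ?thesis
    unfolding two_bridge_gluing_def by blast
qed

end

theory Submission
  imports Defs
begin

text \<open>The double cover of the three-sphere branched along a two-bridge link is a lens space, and for
  slopes other than \<open>\<infinity>\<close> the universal cover of the lens space is again a three-sphere. The
  composite of the two maps is the quotient of the sphere by a dihedral group, generated by a
  rotation \<open>(z, w) \<mapsto> (\<mu> z, \<mu>\<^sup>-\<^sup>B w)\<close> and by complex conjugation in both coordinates. The
  preimage of the link is the union of the great circles that are fixed by the elements
  involving the conjugation, and off these circles the action is free. Hence the link complement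
  has a finite cover that is the complement of a link of great circles; this is the approach of
  G. Walsh to the virtual fibering of two-bridge links.

  Complements of great circles fiber. One circle, the points with both coordinates real, serves
  as the axis: on its complement the direction of \<open>(Im z, Im w)\<close> is a map to a circle, and each
  fiber is an open half-sphere, which the coordinates \<open>(Re z, Re w)\<close> divided by the length of
  \<open>(Im z, Im w)\<close> identify with a plane. A real plane that meets the axis plane only in the origin
  meets each of these fibers once. So the other circles form a closed braid about the axis:
  over the direction \<open>\<theta>\<close> they sit at points \<open>(l cos \<theta>, k sin \<theta>)\<close>, where both the numbers \<open>l\<close>
  and the numbers \<open>k\<close> are pairwise distinct (\<open>fibered_circle_link_complement\<close>). Such a motion of
  points extends to an isotopy of the plane, because for small angles it is carried by
  a shear along the second coordinate and, a quarter turn later, by a shear along the first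
  (\<open>realizable_motion_ellipses\<close>). The end of the isotopy is the monodromy of a fibration with fiber
  a punctured plane (\<open>fibered_motion_complement\<close>), and it preserves the orientation since winding
  numbers do not change along an isotopy.

  All of this is invariant under positive scaling, so the round sphere may be replaced by the
  boundary of the bidisc, the union of the solid tori \<open>cmod z = 1\<close> and \<open>cmod w = 1\<close>. Each of
  them is mapped to one of the two balls by a self-covering of the solid torus followed by the
  explicit folding \<open>solid_fold\<close>, the quotient map by the simultaneous conjugation. The exponents in
  the self-coverings come from the integer matrix of the gluing map
  (\<open>two_bridge_dihedral_cover\<close>), and they make the two maps fit together on the common torus. The
  result is \<open>orbit_map\<close>, which identifies exactly the orbits of the dihedral group
  (\<open>orbit_map_eq_iff\<close>).\<close>

section \<open>Quotient spaces and free actions of finite groups\<close>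

text \<open>Both gluings considered below identify points in disjoint pairs, so the equivalence relation
  that they generate has no chains longer than one step.\<close>

lemma rtrancl_matching:
  assumes "single_valued R" "single_valued (R\<inverse>)" "R O R = {}"
  shows "(R \<union> R\<inverse>)\<^sup>* = Id \<union> R \<union> R\<inverse>"
proof
  show "(R \<union> R\<inverse>)\<^sup>* \<subseteq> Id \<union> R \<union> R\<inverse>"
  proof (rule subrelI)
    fix x y assume "(x, y) \<in> (R \<union> R\<inverse>)\<^sup>*"
    then show "(x, y) \<in> Id \<union> R \<union> R\<inverse>"
    proof (induction rule: rtrancl_induct)
      case (step y z)
      have "(y, z) \<in> R \<Longrightarrow> (x, y) \<notin> R" "(z, y) \<in> R \<Longrightarrow> (y, x) \<notin> R" using assms(3) by blast+
      with step assms(1,2) show ?case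
        unfolding single_valued_def by blast
    qed blast
  qed
qed auto

text \<open>Each map factors through the other, and the two factorizations are inverse to each other.\<close>

lemma homeomorphic_space_quotient_maps:
  assumes f: "quotient_map X Y f" and g: "quotient_map X Z g"
    and eq: "\<And>x y. \<lbrakk>x \<in> topspace X; y \<in> topspace X\<rbrakk> \<Longrightarrow> f x = f y \<longleftrightarrow> g x = g y"
  shows "Y homeomorphic_space Z"
proof -
  obtain k where k: "continuous_map Y Z k" "\<And>x. x \<in> topspace X \<Longrightarrow> k (f x) = g x"
    using quotient_map_lift_exists[OF f quotient_imp_continuous_map[OF g]] eq by metis
  obtain l where l: "continuous_map Z Y l" "\<And>x. x \<in> topspace X \<Longrightarrow> l (g x) = f x"
    using quotient_map_lift_exists[OF g quotient_imp_continuous_map[OF f]] eq by metis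
  have "homeomorphic_maps Y Z k l"
    unfolding homeomorphic_maps_def
    using k l unfolding quotient_imp_surjective_map[OF f, symmetric] quotient_imp_surjective_map[OF g, symmetric] by auto
  then show ?thesis by (auto simp: homeomorphic_space_def)
qed

lemma homeomorphic_glue_space:
  assumes f: "quotient_map X Y f"
    and eq: "\<And>x y. \<lbrakk>x \<in> topspace X; y \<in> topspace X\<rbrakk> \<Longrightarrow> f x = f y \<longleftrightarrow> (x, y) \<in> glue_equiv X R"
  shows "Y homeomorphic_space glue_space X R"
  using f quotient_map_quotient_topology[OF equiv_glue_equiv, of X R]
  unfolding glue_space_def
  by (rule homeomorphic_space_quotient_maps) (simp add: eq eq_equiv_class_iff[OF equiv_glue_equiv])

text \<open>The finitely many translates of a point are distinct and so have disjoint neighbourhoods;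
  shrinking them to the translates of a single neighbourhood gives the sheets over its image.\<close>

lemma finite_free_action_covering:
  assumes N: "Hausdorff_space N" and fin: "finite G" and f: "quotient_map N M f"
    and hom: "\<And>g. g \<in> G \<Longrightarrow> homeomorphic_map N N g" and id: "id \<in> G"
    and orb: "\<And>x y. \<lbrakk>x \<in> topspace N; y \<in> topspace N\<rbrakk> \<Longrightarrow> f x = f y \<longleftrightarrow> (\<exists>g\<in>G. y = g x)"
    and free: "\<And>g k x. \<lbrakk>g \<in> G; k \<in> G; x \<in> topspace N; g x = k x\<rbrakk> \<Longrightarrow> g = k"
  shows "finite_sheeted_covering_map N M f"
proof -
  have im: "g ` topspace N = topspace N" if "g \<in> G" for g
    using hom[OF that] by (rule homeomorphic_imp_surjective_map)
  have gN: "g x \<in> topspace N" if "g \<in> G" "x \<in> topspace N" for g x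
    using im that by blast
  have fg: "f (g x) = f x" if "g \<in> G" "x \<in> topspace N" for g x
    using orb[OF that(2) gN[OF that]] that(1) by auto
  have sat: "{x \<in> topspace N. f x \<in> f ` W} = (\<Union>g\<in>G. g ` W)" if "W \<subseteq> topspace N" for W
  proof
    show "{x \<in> topspace N. f x \<in> f ` W} \<subseteq> (\<Union>g\<in>G. g ` W)"
    proof clarify
      fix x w assume x: "x \<in> topspace N" "f x = f w" "w \<in> W"
      have "w \<in> topspace N" using x(3) that by blast
      then obtain g where "g \<in> G" "x = g w" using orb[of w x] x by auto
      then show "x \<in> (\<Union>g\<in>G. g ` W)" using x by blast
    qed
    show "(\<Union>g\<in>G. g ` W) \<subseteq> {x \<in> topspace N. f x \<in> f ` W}"
    proof clarify
      fix g w assume "g \<in> G" "w \<in> W"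
      moreover from this have "w \<in> topspace N" using that by blast
      ultimately show "g w \<in> topspace N \<and> f (g w) \<in> f ` W" by (simp add: gN fg)
    qed
  qed
  have gopen: "openin N (g ` W)" if "g \<in> G" "openin N W" for g W
    using homeomorphic_imp_open_map[OF hom[OF that(1)]] that(2) by (simp add: open_map_def)
  have op: "open_map N M f"
    unfolding open_map_def
  proof (intro allI impI)
    fix W assume W: "openin N W"
    then have sub: "W \<subseteq> topspace N" by (rule openin_subset)
    have "openin N {x \<in> topspace N. f x \<in> f ` W}"
      unfolding sat[OF sub] using gopen W by (auto intro: openin_Union)
    moreover have "f ` W \<subseteq> topspace M"
      using sub quotient_imp_surjective_map[OF f] by blast
    ultimately show "openin M (f ` W)" using f unfolding quotient_map_def by blast
  qed
  have "\<exists>T. y \<in> T \<and> openin M T \<and>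
        (\<exists>\<V>. \<Union>\<V> = {x \<in> topspace N. f x \<in> T} \<and> (\<forall>V\<in>\<V>. openin N V) \<and> pairwise disjnt \<V> \<and>
             (\<forall>V\<in>\<V>. homeomorphic_map (subtopology N V) (subtopology M T) f))"
    if y: "y \<in> topspace M" for y
  proof -
    obtain x where x: "x \<in> topspace N" "f x = y"
      using y unfolding quotient_imp_surjective_map[OF f, symmetric] by auto
    have "\<exists>U U'. openin N U \<and> openin N U' \<and> g x \<in> U \<and> k x \<in> U' \<and> disjnt U U'"
      if "g \<in> G" "k \<in> G" "g \<noteq> k" for g k
    proof -
      have "g x \<noteq> k x" using free[OF that(1,2) x(1)] that(3) by blast
      then show ?thesis
        using N gN[OF that(1) x(1)] gN[OF that(2) x(1)] unfolding Hausdorff_space_def by blast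
    qed
    then obtain A B where AB: "\<And>g k. \<lbrakk>g \<in> G; k \<in> G; g \<noteq> k\<rbrakk> \<Longrightarrow>
        openin N (A g k) \<and> openin N (B g k) \<and> g x \<in> A g k \<and> k x \<in> B g k \<and> disjnt (A g k) (B g k)"
      by metis
    \<comment> \<open>The set \<open>V\<close> consists of the points whose translates under distinct elements \<open>g\<close> and \<open>k\<close> are
      separated by the same sets as the translates of \<open>x\<close>.\<close>
    define P where "P = {(g, k). g \<in> G \<and> k \<in> G \<and> g \<noteq> k}"
    have finP: "finite P"
      by (rule finite_subset[of _ "G \<times> G"]) (auto simp: P_def fin)
    define pre where "pre = (\<lambda>(g, k). {z \<in> topspace N. g z \<in> A g k} \<inter> {z \<in> topspace N. k z \<in> B g k})"
    define V where "V = topspace N \<inter> (\<Inter>p\<in>P. pre p)"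
    have "openin N (pre p)" if "p \<in> P" for p
      using that AB homeomorphic_imp_continuous_map[OF hom]
      by (auto simp: P_def pre_def intro!: openin_Int openin_continuous_map_preimage)
    then have V: "openin N V"
      unfolding V_def using finP
      by (cases "P = {}") (auto intro!: openin_Int openin_Inter)
    have VN: "V \<subseteq> topspace N" by (auto simp: V_def)
    have xV: "x \<in> V" using x AB by (auto simp: V_def P_def pre_def)
    have dis: "g = k" if "g \<in> G" "k \<in> G" "v \<in> V" "w \<in> V" "g v = k w" for g k v w
    proof (rule ccontr)
      assume "g \<noteq> k"
      then have "(g, k) \<in> P" using that by (simp add: P_def)
      then have "g v \<in> A g k" "k w \<in> B g k" using that(3,4) by (auto simp: V_def pre_def)
      then show False using AB[OF that(1,2) \<open>g \<noteq> k\<close>] that(5) by (auto simp: disjnt_iff)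
    qed
    have T: "openin M (f ` V)" using op V by (simp add: open_map_def)
    have hm: "homeomorphic_map (subtopology N (g ` V)) (subtopology M (f ` V)) f" if g: "g \<in> G" for g
    proof (rule bijective_open_imp_homeomorphic_map)
      have gV: "g ` V \<subseteq> topspace N" using gN[OF g] VN by blast
      have fgV: "f ` g ` V = f ` V" using fg[OF g] VN by (force simp: image_image)
      show "continuous_map (subtopology N (g ` V)) (subtopology M (f ` V)) f"
        using quotient_imp_continuous_map[OF f] fgV
        by (auto simp: continuous_map_in_subtopology continuous_map_from_subtopology)
      show "open_map (subtopology N (g ` V)) (subtopology M (f ` V)) f"
        unfolding open_map_def
      proof (intro allI impI)
        fix W assume "openin (subtopology N (g ` V)) W"
        then have W: "openin N W" "W \<subseteq> g ` V"
          using gopen[OF g V] by (auto simp: openin_open_subtopology)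
        then have "openin M (f ` W)" "f ` W \<subseteq> f ` V"
          using op fgV by (simp add: open_map_def, blast)
        then show "openin (subtopology M (f ` V)) (f ` W)"
          using T by (simp add: openin_open_subtopology)
      qed
      show "f ` topspace (subtopology N (g ` V)) = topspace (subtopology M (f ` V))"
        using gV fgV openin_subset[OF T] by (simp add: Int_absorb1)
      show "inj_on f (topspace (subtopology N (g ` V)))"
      proof (rule inj_onI)
        fix a b assume "a \<in> topspace (subtopology N (g ` V))" "b \<in> topspace (subtopology N (g ` V))" "f a = f b"
        then obtain v w where vw: "v \<in> V" "w \<in> V" "a = g v" "b = g w" by auto
        have vwN: "v \<in> topspace N" "w \<in> topspace N" using vw VN by blast+
        then have "f v = f w" using \<open>f a = f b\<close> fg[OF g] vw(3,4) by simp
        then obtain k where k: "k \<in> G" "w = k v" using orb[OF vwN] by blast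
        then have "k = id" using dis[OF k(1) id vw(1,2)] by simp
        then show "a = b" using k vw by simp
      qed
    qed
    show ?thesis
    proof (intro exI[of _ "f ` V"] exI[of _ "(\<lambda>g. g ` V) ` G"] conjI)
      show "pairwise disjnt ((\<lambda>g. g ` V) ` G)"
        unfolding pairwise_def disjnt_iff
      proof clarify
        fix g k v w
        assume "g \<in> G" "k \<in> G" "g ` V \<noteq> k ` V" "v \<in> V" "w \<in> V" "g v = k w"
        then show False using dis[of g k v w] by blast
      qed
      show "y \<in> f ` V" using xV x(2) by blast
      show "openin M (f ` V)" by (rule T)
      show "\<Union> ((\<lambda>g. g ` V) ` G) = {x \<in> topspace N. f x \<in> f ` V}" by (rule sat[OF VN, symmetric])
      show "\<forall>U\<in>(\<lambda>g. g ` V) ` G. openin N U" using gopen V by blast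
      show "\<forall>U\<in>(\<lambda>g. g ` V) ` G. homeomorphic_map (subtopology N U) (subtopology M (f ` V)) f" using hm by blast
    qed
  qed
  moreover have "finite {x \<in> topspace N. f x = y}" if y: "y \<in> topspace M" for y
  proof -
    obtain x where x: "x \<in> topspace N" "f x = y"
      using y unfolding quotient_imp_surjective_map[OF f, symmetric] by auto
    have "{z \<in> topspace N. f z = y} \<subseteq> (\<lambda>g. g x) ` G"
    proof clarify
      fix z assume z: "z \<in> topspace N" "y = f z"
      then obtain g where "g \<in> G" "z = g x" using orb[OF x(1) z(1)] x(2) by auto
      then show "z \<in> (\<lambda>g. g x) ` G" by blast
    qed
    then show ?thesis using fin finite_surj by blast
  qed
  ultimately show ?thesis
    unfolding finite_sheeted_covering_map_def covering_map_def
    using quotient_imp_continuous_map[OF f] quotient_imp_surjective_map[OF f] by (intro conjI ballI)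
qed

section \<open>Isotopies of the plane\<close>

text \<open>The inverses \<open>T'\<close> are part of the data because they, too, have to depend continuously on the
  time.\<close>

definition isotopy_on :: "real \<Rightarrow> real \<Rightarrow> (real \<Rightarrow> complex \<Rightarrow> complex) \<Rightarrow> (real \<Rightarrow> complex \<Rightarrow> complex) \<Rightarrow> bool" where
  "isotopy_on s t T T' \<longleftrightarrow>
     continuous_on ({s..t} \<times> UNIV) (\<lambda>(\<tau>, x). T \<tau> x) \<and>
     continuous_on ({s..t} \<times> UNIV) (\<lambda>(\<tau>, x). T' \<tau> x) \<and>
     (\<forall>\<tau>\<in>{s..t}. \<forall>x. T' \<tau> (T \<tau> x) = x \<and> T \<tau> (T' \<tau> x) = x)"

lemma isotopy_on_sym: "isotopy_on s t T T' \<Longrightarrow> isotopy_on s t T' T"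
  by (auto simp: isotopy_on_def)

lemma isotopy_on_continuous:
  assumes "isotopy_on s t T T'" "continuous_on A f" "continuous_on A g" "f ` A \<subseteq> {s..t}"
  shows "continuous_on A (\<lambda>a. T (f a) (g a))"
proof -
  have "continuous_on A ((\<lambda>(\<tau>, x). T \<tau> x) \<circ> (\<lambda>a. (f a, g a)))"
    using assms unfolding isotopy_on_def
    by (intro continuous_on_compose continuous_intros) (auto intro: continuous_on_subset)
  then show ?thesis by (simp add: o_def)
qed

text \<open>The point \<open>j\<close> is at \<open>p \<tau> j\<close> at time \<open>\<tau>\<close>, and all points are dragged along by one ambient isotopy
  that starts at the identity.\<close>

definition realizable_motion :: "real \<Rightarrow> real \<Rightarrow> 'j set \<Rightarrow> (real \<Rightarrow> 'j \<Rightarrow> complex) \<Rightarrow> bool" where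
  "realizable_motion s t J p \<longleftrightarrow>
     (\<exists>T T'. isotopy_on s t T T' \<and> (\<forall>x. T s x = x) \<and> (\<forall>\<tau>\<in>{s..t}. \<forall>j\<in>J. T \<tau> (p s j) = p \<tau> j))"

lemma realizable_motion_based:
  assumes "isotopy_on s t T T'" "\<And>x. T s x = x" "\<And>\<tau> j. \<lbrakk>\<tau> \<in> {s..t}; j \<in> J\<rbrakk> \<Longrightarrow> T \<tau> (p s j) = p \<tau> j"
  shows "realizable_motion s t J p"
  using assms unfolding realizable_motion_def by blast

text \<open>The isotopy need not start at the identity: precomposing it with the inverse of its initial
  stage does not change the points that it traces out.\<close>

lemma realizable_motionI:
  assumes T: "isotopy_on s t T T'" and "s \<le> t" and p: "\<And>\<tau> j. \<lbrakk>\<tau> \<in> {s..t}; j \<in> J\<rbrakk> \<Longrightarrow> T \<tau> (z j) = p \<tau> j"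
  shows "realizable_motion s t J p"
proof (rule realizable_motion_based)
  have s: "s \<in> {s..t}" using assms(2) by simp
  show "isotopy_on s t (\<lambda>\<tau> x. T \<tau> (T' s x)) (\<lambda>\<tau> x. T s (T' \<tau> x))"
    unfolding isotopy_on_def case_prod_unfold
  proof (intro conjI ballI allI)
    show "continuous_on ({s..t} \<times> UNIV) (\<lambda>a. T (fst a) (T' s (snd a)))"
      by (rule isotopy_on_continuous[OF T] isotopy_on_continuous[OF isotopy_on_sym[OF T]] continuous_intros | use s in force)+
    show "continuous_on ({s..t} \<times> UNIV) (\<lambda>a. T s (T' (fst a) (snd a)))"
      by (rule isotopy_on_continuous[OF T] isotopy_on_continuous[OF isotopy_on_sym[OF T]] continuous_intros | use s in force)+
  qed (use T s in \<open>simp_all add: isotopy_on_def\<close>)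
  show "T s (T' s x) = x" for x using T s by (simp add: isotopy_on_def)
next
  have s: "s \<in> {s..t}" using assms(2) by simp
  fix \<tau> j assume "\<tau> \<in> {s..t}" "j \<in> J"
  then have "T \<tau> (T' s (p s j)) = T \<tau> (T' s (T s (z j)))" using p[OF s] by simp
  also have "T' s (T s (z j)) = z j" using T s by (simp add: isotopy_on_def)
  also have "T \<tau> (z j) = p \<tau> j" by (rule p) fact+
  finally show "T \<tau> (T' s (p s j)) = p \<tau> j" .
qed

lemma realizable_motion_join:
  assumes 1: "realizable_motion s m J p" and 2: "realizable_motion m t J p" and "s \<le> m" "m \<le> t"
  shows "realizable_motion s t J p"
proof -
  obtain T T' where T: "isotopy_on s m T T'" "\<And>x. T s x = x" "\<And>\<tau> j. \<lbrakk>\<tau> \<in> {s..m}; j \<in> J\<rbrakk> \<Longrightarrow> T \<tau> (p s j) = p \<tau> j"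
    using 1 by (auto simp: realizable_motion_def)
  obtain U U' where U: "isotopy_on m t U U'" "\<And>x. U m x = x" "\<And>\<tau> j. \<lbrakk>\<tau> \<in> {m..t}; j \<in> J\<rbrakk> \<Longrightarrow> U \<tau> (p m j) = p \<tau> j"
    using 2 by (auto simp: realizable_motion_def)
  have U'm: "U' m x = x" for x using U(1,2) assms(4) by (metis atLeastAtMost_iff isotopy_on_def order_refl)
  let ?V = "\<lambda>\<tau> x. if \<tau> \<le> m then T \<tau> x else U \<tau> (T m x)"
  let ?V' = "\<lambda>\<tau> x. if \<tau> \<le> m then T' \<tau> x else T' m (U' \<tau> x)"
  note cT = isotopy_on_continuous[OF T(1)] isotopy_on_continuous[OF isotopy_on_sym[OF T(1)]]
    isotopy_on_continuous[OF U(1)] isotopy_on_continuous[OF isotopy_on_sym[OF U(1)]]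
  have "isotopy_on s t ?V ?V'"
    unfolding isotopy_on_def case_prod_unfold
  proof (intro conjI)
    show "continuous_on ({s..t} \<times> UNIV) (\<lambda>a. ?V (fst a) (snd a))"
      using assms(3,4) U(2)
      by (intro continuous_on_cases_le continuous_intros cT) auto
    show "continuous_on ({s..t} \<times> UNIV) (\<lambda>a. ?V' (fst a) (snd a))"
      using assms(3,4) U'm
      by (intro continuous_on_cases_le continuous_intros cT) auto
    show "\<forall>\<tau>\<in>{s..t}. \<forall>x. ?V' \<tau> (?V \<tau> x) = x \<and> ?V \<tau> (?V' \<tau> x) = x"
      using T(1) U(1) assms(3,4) by (simp add: isotopy_on_def)
  qed
  moreover have "?V \<tau> (p s j) = p \<tau> j" if "\<tau> \<in> {s..t}" "j \<in> J" for \<tau> j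
    using T(3) U(3) that assms(3,4) by simp
  ultimately show ?thesis
    using T(2) assms(3) by (intro realizable_motion_based[of _ _ ?V ?V']) simp_all
qed

lemma realizable_motion_reparametrize:
  assumes p: "realizable_motion (r * s + c) (r * t + c) J p" and "0 \<le> r"
  shows "realizable_motion s t J (\<lambda>\<tau>. p (r * \<tau> + c))"
proof -
  obtain T T' where T: "isotopy_on (r * s + c) (r * t + c) T T'" "\<And>x. T (r * s + c) x = x"
    "\<And>\<tau> j. \<lbrakk>\<tau> \<in> {r * s + c..r * t + c}; j \<in> J\<rbrakk> \<Longrightarrow> T \<tau> (p (r * s + c) j) = p \<tau> j"
    using p by (auto simp: realizable_motion_def)
  have r: "r * \<tau> + c \<in> {r * s + c..r * t + c}" if "\<tau> \<in> {s..t}" for \<tau>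
    using that \<open>0 \<le> r\<close> by (auto intro: mult_left_mono)
  have "isotopy_on s t (\<lambda>\<tau>. T (r * \<tau> + c)) (\<lambda>\<tau>. T' (r * \<tau> + c))"
    unfolding isotopy_on_def case_prod_unfold
  proof (intro conjI)
    show "continuous_on ({s..t} \<times> UNIV) (\<lambda>a. T (r * fst a + c) (snd a))"
      using r by (intro isotopy_on_continuous[OF T(1)] continuous_intros) auto
    show "continuous_on ({s..t} \<times> UNIV) (\<lambda>a. T' (r * fst a + c) (snd a))"
      using r by (intro isotopy_on_continuous[OF isotopy_on_sym[OF T(1)]] continuous_intros) auto
  qed (use T(1) r in \<open>auto simp: isotopy_on_def\<close>)
  then show ?thesis
    by (rule realizable_motion_based) (use T(2,3) r in auto)
qed

lemma realizable_motion_scale: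
  assumes p: "realizable_motion s t J p" and "c \<noteq> 0"
  shows "realizable_motion s t J (\<lambda>\<tau> j. c * p \<tau> j)"
proof -
  obtain T T' where T: "isotopy_on s t T T'" "\<And>x. T s x = x"
    "\<And>\<tau> j. \<lbrakk>\<tau> \<in> {s..t}; j \<in> J\<rbrakk> \<Longrightarrow> T \<tau> (p s j) = p \<tau> j"
    using p by (auto simp: realizable_motion_def)
  have "isotopy_on s t (\<lambda>\<tau> x. c * T \<tau> (x / c)) (\<lambda>\<tau> x. c * T' \<tau> (x / c))"
    unfolding isotopy_on_def case_prod_unfold
  proof (intro conjI)
    show "continuous_on ({s..t} \<times> UNIV) (\<lambda>a. c * T (fst a) (snd a / c))"
      using \<open>c \<noteq> 0\<close> by (intro isotopy_on_continuous[OF T(1)] continuous_intros) auto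
    show "continuous_on ({s..t} \<times> UNIV) (\<lambda>a. c * T' (fst a) (snd a / c))"
      using \<open>c \<noteq> 0\<close> by (intro isotopy_on_continuous[OF isotopy_on_sym[OF T(1)]] continuous_intros) auto
  qed (use T(1) \<open>c \<noteq> 0\<close> in \<open>auto simp: isotopy_on_def\<close>)
  then show ?thesis
    by (rule realizable_motion_based) (use T(2,3) \<open>c \<noteq> 0\<close> in auto)
qed

text \<open>A function \<open>f\<close> with \<open>f (l j) = k j\<close> exists because the \<open>l j\<close> are distinct. The maps
  \<open>(x, y) \<mapsto> (x cos \<tau>, y + sin \<tau> f(x))\<close> then send \<open>(l j, 0)\<close> to the required positions, and they
  are homeomorphisms as long as \<open>cos \<tau>\<close> does not vanish.\<close>

lemma realizable_motion_shear:
  fixes l k :: "'j \<Rightarrow> real"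
  assumes "finite J" "inj_on l J" and st: "- (pi/2) < s" "s \<le> t" "t < pi/2"
  shows "realizable_motion s t J (\<lambda>\<tau> j. Complex (l j * cos \<tau>) (k j * sin \<tau>))"
proof -
  obtain f :: "real \<Rightarrow> real" where f: "continuous_on UNIV f" "\<And>j. j \<in> J \<Longrightarrow> f (l j) = k j"
  proof -
    have "closedin (top_of_set UNIV) (l ` J)"
      using assms(1) by (simp add: finite_imp_closed)
    moreover have "continuous_on (l ` J) (k \<circ> inv_into J l)"
      using assms(1) by (simp add: continuous_on_finite)
    ultimately obtain g where "continuous_on UNIV g" "\<And>x. x \<in> l ` J \<Longrightarrow> g x = (k \<circ> inv_into J l) x"
      using Tietze_unbounded[of "l ` J" "k \<circ> inv_into J l" UNIV] by blast
    then show ?thesis using that[of g] assms(2) by simp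
  qed
  have cf: "continuous_on A (\<lambda>a. f (g a))" if "continuous_on A g" for A and g :: "real \<times> complex \<Rightarrow> real"
    using continuous_on_compose2[OF f(1) that] by simp
  have pos: "0 < cos \<tau>" if "\<tau> \<in> {s..t}" for \<tau> using that st by (intro cos_gt_zero_pi) auto
  show ?thesis
  proof (rule realizable_motionI)
    show "isotopy_on s t (\<lambda>\<tau> x. Complex (Re x * cos \<tau>) (Im x + sin \<tau> * f (Re x)))
      (\<lambda>\<tau> x. Complex (Re x / cos \<tau>) (Im x - sin \<tau> * f (Re x / cos \<tau>)))"
      unfolding isotopy_on_def case_prod_unfold Complex_eq
    proof (intro conjI)
      show "\<forall>\<tau>\<in>{s..t}. \<forall>x. of_real (Re (of_real (Re x * cos \<tau>) + \<i> * of_real (Im x + sin \<tau> * f (Re x))) / cos \<tau>) +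
              \<i> * of_real (Im (of_real (Re x * cos \<tau>) + \<i> * of_real (Im x + sin \<tau> * f (Re x))) -
                    sin \<tau> * f (Re (of_real (Re x * cos \<tau>) + \<i> * of_real (Im x + sin \<tau> * f (Re x))) / cos \<tau>)) = x \<and>
              of_real (Re (of_real (Re x / cos \<tau>) + \<i> * of_real (Im x - sin \<tau> * f (Re x / cos \<tau>))) * cos \<tau>) +
              \<i> * of_real (Im (of_real (Re x / cos \<tau>) + \<i> * of_real (Im x - sin \<tau> * f (Re x / cos \<tau>))) +
                    sin \<tau> * f (Re (of_real (Re x / cos \<tau>) + \<i> * of_real (Im x - sin \<tau> * f (Re x / cos \<tau>))))) = x"
        using pos by (force simp: complex_eq_iff)
    qed (intro continuous_intros cf; use pos in force)+
    show "Complex (Re (of_real (l j)) * cos \<tau>) (Im (of_real (l j)) + sin \<tau> * f (Re (of_real (l j)))) =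
        Complex (l j * cos \<tau>) (k j * sin \<tau>)" if "j \<in> J" for \<tau> j
      using f(2)[OF that] by simp
  qed (use st in auto)
qed

text \<open>A quarter turn of the plane exchanges the roles of \<open>l\<close> and \<open>k\<close>. So the full period splits into
  four quarters, centred at the multiples of \<open>pi/2\<close>, each of which is a rotated shear motion that
  stays away from the zeros of the cosine.\<close>

lemma realizable_motion_ellipses:
  fixes l k :: "'j \<Rightarrow> real"
  assumes J: "finite J" and l: "inj_on l J" and k: "inj_on k J"
  shows "realizable_motion (- (pi/4)) (7*pi/4) J (\<lambda>\<tau> j. Complex (l j * cos \<tau>) (k j * sin \<tau>))"
    (is "realizable_motion _ _ J ?p")
proof -
  let ?q = "\<lambda>\<tau> j. Complex (k j * cos \<tau>) (l j * sin \<tau>)"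
  have p: "realizable_motion (- (pi/4)) (pi/4) J ?p" and q: "realizable_motion (- (pi/4)) (pi/4) J ?q"
    by (rule realizable_motion_shear[OF J l]; simp) (rule realizable_motion_shear[OF J k]; simp)
  have sh: "realizable_motion (c - pi/4) (c + pi/4) J (\<lambda>\<tau>. r (\<tau> - c))"
    if "realizable_motion (- (pi/4)) (pi/4) J r" for r :: "real \<Rightarrow> 'j \<Rightarrow> complex" and c
    using realizable_motion_reparametrize[of 1 "c - pi/4" "- c" "c + pi/4" J r] that by simp
  have e1: "\<i> * ?q (\<tau> - pi/2) j = ?p \<tau> j" for \<tau> j
    by (simp add: complex_eq_iff cos_diff sin_diff)
  have e2: "(- 1) * ?p (\<tau> - pi) j = ?p \<tau> j" for \<tau> j
    by (simp add: complex_eq_iff cos_diff sin_diff)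
  have c3: "cos (3*pi/2) = 0" "sin (3*pi/2) = -1"
    using cos_3over2_pi sin_3over2_pi by auto
  have e3: "(- \<i>) * ?q (\<tau> - 3*pi/2) j = ?p \<tau> j" for \<tau> j
    by (simp add: complex_eq_iff cos_diff sin_diff c3)
  have "realizable_motion (pi/4) (3*pi/4) J ?p"
    using sh[OF realizable_motion_scale[OF q, of \<i>], of "pi/2"] unfolding e1 by (simp add: field_simps)
  moreover have "realizable_motion (3*pi/4) (5*pi/4) J ?p"
    using sh[OF realizable_motion_scale[OF p, of "- 1"], of "pi"] unfolding e2 by (simp add: field_simps)
  moreover have "realizable_motion (5*pi/4) (7*pi/4) J ?p"
    using sh[OF realizable_motion_scale[OF q, of "- \<i>"], of "3*pi/2"] unfolding e3 by (simp add: field_simps)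
  ultimately show ?thesis
    using p
    by (intro realizable_motion_join[of "- (pi/4)" "pi/4" J ?p "7*pi/4"] realizable_motion_join[of "pi/4" "3*pi/4" J ?p "7*pi/4"]
        realizable_motion_join[of "3*pi/4" "5*pi/4" J ?p "7*pi/4"]) auto
qed

text \<open>The images of the circle relative to the image of its centre form a homotopy of loops that
  avoids the origin, from the original circle to its final image.\<close>

lemma isotopy_on_winding_number:
  assumes T: "isotopy_on 0 1 T T'" and id: "\<And>x. T 0 x = x" and r: "0 < r"
  shows "winding_number (T 1 \<circ> circlepath z r) (T 1 z) = 1"
proof -
  let ?h = "\<lambda>(\<tau>, u). T \<tau> (circlepath z r u) - T \<tau> z"
  have inj: "T \<tau> x = T \<tau> y \<longleftrightarrow> x = y" if "\<tau> \<in> {0..1}" for \<tau> x y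
    using T that unfolding isotopy_on_def by metis
  have "homotopic_loops (- {0}) (\<lambda>u. circlepath z r u - z) (\<lambda>u. T 1 (circlepath z r u) - T 1 z)"
    unfolding homotopic_loops
  proof (intro exI[of _ ?h] conjI ballI)
    have cp: "continuous_on {0..1} (circlepath z r)"
      using path_circlepath[of z r] by (simp add: path_def)
    show "continuous_on ({0..1} \<times> {0..1}) ?h"
      unfolding case_prod_unfold
      by (intro continuous_intros isotopy_on_continuous[OF T] continuous_on_compose2[OF cp]) auto
    have "circlepath z r u \<noteq> z" if "u \<in> {0..1}" for u
      using r by (simp add: circlepath)
    then show "?h \<in> {0..1} \<times> {0..1} \<rightarrow> - {0}"
      using inj by auto
    show "pathfinish (?h \<circ> Pair \<tau>) = pathstart (?h \<circ> Pair \<tau>)" for \<tau>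
      using pathfinish_circlepath[of z r] pathstart_circlepath[of z r] 
      by (simp add: pathfinish_def pathstart_def)
  qed (auto simp: id)
  then have "winding_number (\<lambda>u. circlepath z r u - z) 0 = winding_number (\<lambda>u. T 1 (circlepath z r u) - T 1 z) 0"
    by (rule winding_number_homotopic_loops)
  then show ?thesis
    using winding_number_offset[of "T 1 \<circ> circlepath z r" "T 1 z"] winding_number_offset[of "circlepath z r" z]
      winding_number_circlepath_centre[OF r, of z] by simp
qed

section \<open>Mapping tori of punctured planes\<close>

lemma glue_equiv_mapping_torus:
  fixes F :: "'a topology"
  assumes "inj_on \<psi> (topspace F)"
  shows "glue_equiv (prod_topology F (top_of_set {0..1::real})) {((x, 0), (\<psi> x, 1)) | x. x \<in> topspace F} =
    Restr (Id \<union> {((x, 0), (\<psi> x, 1)) | x. x \<in> topspace F} \<union> {((\<psi> x, 1), (x, 0)) | x. x \<in> topspace F})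
      (topspace F \<times> {0..1})"
proof -
  let ?R = "{((x, 0), (\<psi> x, 1)) | x. x \<in> topspace F} :: (('a \<times> real) \<times> ('a \<times> real)) set"
  have "(?R \<union> ?R\<inverse>)\<^sup>* = Id \<union> ?R \<union> ?R\<inverse>"
  proof (rule rtrancl_matching)
    show "single_valued (?R\<inverse>)"
      using assms by (auto simp: single_valued_def inj_on_def)
  qed (auto simp: single_valued_def)
  moreover have "?R\<inverse> = {((\<psi> x, 1), (x, 0)) | x. x \<in> topspace F}" by blast
  ultimately show ?thesis by (simp add: glue_equiv_def)
qed

text \<open>The condition involves only circles inside \<open>S\<close>, so values elsewhere do not matter, such as those
  of the inverse chart \<open>inv_into\<close> off the image of the chart.\<close>

lemma sense_preserving_on_cong:
  assumes "\<And>z. z \<in> S \<Longrightarrow> f z = g z"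
  shows "sense_preserving_on S f \<longleftrightarrow> sense_preserving_on S g"
proof -
  have "winding_number (f \<circ> circlepath z r) (f z) = winding_number (g \<circ> circlepath z r) (g z)"
    if "0 < r" "cball z r \<subseteq> S" for z r
  proof -
    have "z \<in> S" using that by auto
    have "(f \<circ> circlepath z r) t = (g \<circ> circlepath z r) t" if t: "0 \<le> t" "t \<le> 1" for t
    proof -
      have "circlepath z r t \<in> path_image (circlepath z r)" using t by (simp add: path_image_def)
      also have "\<dots> \<subseteq> S" using \<open>0 < r\<close> \<open>cball z r \<subseteq> S\<close> by (auto simp: path_image_circlepath_nonneg)
      finally show ?thesis using assms by simp
    qed
    then have "winding_number (f \<circ> circlepath z r) (g z) = winding_number (g \<circ> circlepath z r) (g z)"
      by (rule winding_number_cong)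
    then show ?thesis by (simp only: assms[OF \<open>z \<in> S\<close>])
  qed
  then show ?thesis by (auto simp: sense_preserving_on_def)
qed

lemma oriented_surface_punctured_plane:
  fixes B :: "complex set"
  assumes "finite B"
  shows "oriented_surface (top_of_set (- B)) {(- B, id)}"
proof -
  have op: "open (- B)" using assms by (simp add: finite_imp_closed open_Compl)
  have ne: "- B \<noteq> {}"
    using assms infinite_UNIV_char_0[where 'a = complex] by (metis Compl_empty_eq double_complement)
  have "connected (UNIV - B)"
    using assms by (intro connected_open_delete_finite) auto
  then have conn: "connected (- B)" by (simp add: Compl_eq_Diff_UNIV)
  obtain \<B> :: "complex set set" where "countable \<B>" "\<And>C. C \<in> \<B> \<Longrightarrow> open C" "\<And>S. open S \<Longrightarrow> \<exists>U. U \<subseteq> \<B> \<and> S = \<Union>U"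
    using univ_second_countable by blast
  then have "second_countable (euclidean :: complex topology)"
    unfolding second_countable_def
  proof (intro exI[of _ \<B>] conjI allI impI ballI)
    fix U :: "complex set" and x
    assume "openin euclidean U \<and> x \<in> U"
    then obtain \<U> where "\<U> \<subseteq> \<B>" "U = \<Union>\<U>" "x \<in> U"
      using \<open>\<And>S. open S \<Longrightarrow> \<exists>U. U \<subseteq> \<B> \<and> S = \<Union>U\<close>[of U] by auto
    then show "\<exists>V\<in>\<B>. x \<in> V \<and> V \<subseteq> U" by blast
  qed auto
  moreover have "sense_preserving_on (- B) (id \<circ> inv_into (- B) id)"
  proof -
    have "(id \<circ> inv_into (- B) id) z = z" if "z \<in> - B" for z
      using inv_into_f_f[of id "- B" z] that by simp
    then have "sense_preserving_on (- B) (id \<circ> inv_into (- B) id) \<longleftrightarrow> sense_preserving_on (- B) (\<lambda>z. z)"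
      by (rule sense_preserving_on_cong)
    then show ?thesis by (simp add: sense_preserving_on_def o_def winding_number_circlepath_centre)
  qed
  ultimately show ?thesis
    unfolding oriented_surface_def
    using ne conn op
    by (simp add: connected_space_subtopology Hausdorff_space_subtopology second_countable_subtopology subtopology_subtopology)
qed

lemma homeomorphic_fibered:
  "M homeomorphic_space N \<Longrightarrow> fibered N \<Longrightarrow> fibered M"
  unfolding fibered_def using homeomorphic_space_trans by blast

text \<open>The isotopy straightens the moving points: it turns the product of the punctured plane with the
  time interval into the given space cut open at time \<open>0\<close>. Regluing identifies \<open>(x, 0)\<close>
  with \<open>(y, 1)\<close> when \<open>x\<close> is the final position of \<open>y\<close>; hence the monodromy is the inverse of the
  final stage of the isotopy.\<close>

lemma fibered_motion_complement:
  fixes p :: "real \<Rightarrow> 'j \<Rightarrow> complex" and e :: "real \<Rightarrow> complex"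
  assumes "finite J" and motion: "realizable_motion 0 1 J p" and closed: "p 1 ` J = p 0 ` J"
    and e: "continuous_on {0..1} e"
      "\<And>\<tau> \<sigma>. \<lbrakk>\<tau> \<in> {0..1}; \<sigma> \<in> {0..1}\<rbrakk> \<Longrightarrow> e \<tau> = e \<sigma> \<longleftrightarrow> \<tau> = \<sigma> \<or> \<tau> = 0 \<and> \<sigma> = 1 \<or> \<tau> = 1 \<and> \<sigma> = 0"
  shows "fibered (top_of_set {(z, e \<tau>) | z \<tau>. \<tau> \<in> {0..1} \<and> z \<notin> p \<tau> ` J})"
proof -
  obtain T T' where T: "isotopy_on 0 1 T T'" "\<And>x. T 0 x = x"
    "\<And>\<tau> j. \<lbrakk>\<tau> \<in> {0..1}; j \<in> J\<rbrakk> \<Longrightarrow> T \<tau> (p 0 j) = p \<tau> j"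
    using motion unfolding realizable_motion_def by blast
  have TT': "T' \<tau> (T \<tau> x) = x" "T \<tau> (T' \<tau> x) = x" if "\<tau> \<in> {0..1}" for \<tau> x
    using T(1) that by (auto simp: isotopy_on_def)
  have T'0: "T' 0 x = x" for x using TT'(1)[of 0 x] T(2) by simp
  define B where "B = p 0 ` J"
  define F where "F = top_of_set (- B)"
  define W where "W = {(z, e \<tau>) | z \<tau>. \<tau> \<in> {0..1} \<and> z \<notin> p \<tau> ` J}"
  define \<psi> where "\<psi> = T' 1"
  have TB: "T \<tau> x \<in> p \<tau> ` J \<longleftrightarrow> x \<in> B" if "\<tau> \<in> {0..1}" for \<tau> x
  proof -
    have "p \<tau> ` J = T \<tau> ` B" using T(3)[OF that] by (force simp: B_def)
    moreover have "inj (T \<tau>)" using TT'(1)[OF that] by (metis injI)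
    ultimately show ?thesis by (simp add: inj_image_mem_iff)
  qed
  have T1B: "T 1 x \<in> B \<longleftrightarrow> x \<in> B" for x using TB[of 1 x] closed by (simp add: B_def)
  have \<psi>B: "\<psi> x \<in> B \<longleftrightarrow> x \<in> B" for x using T1B[of "\<psi> x"] TT' by (simp add: \<psi>_def)
  have inW: "(z, e \<tau>) \<in> W \<longleftrightarrow> z \<notin> p \<tau> ` J" if "\<tau> \<in> {0..1}" for z \<tau>
  proof
    assume "(z, e \<tau>) \<in> W"
    then obtain \<sigma> where \<sigma>: "\<sigma> \<in> {0..1}" "e \<tau> = e \<sigma>" "z \<notin> p \<sigma> ` J" by (auto simp: W_def)
    then have "p \<tau> ` J = p \<sigma> ` J" using e(2)[OF that \<sigma>(1)] \<sigma>(2) closed by metis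
    then show "z \<notin> p \<tau> ` J" using \<sigma>(3) by simp
  next
    assume "z \<notin> p \<tau> ` J"
    then show "(z, e \<tau>) \<in> W" unfolding W_def using that by blast
  qed

  let ?I = "{0..1::real}"
  let ?X = "prod_topology (euclidean :: complex topology) (top_of_set ?I)"
  let ?Y = "prod_topology (euclidean :: complex topology) (top_of_set (e ` ?I))"
  have X: "?X = top_of_set (UNIV \<times> ?I)" and Y: "?Y = top_of_set (UNIV \<times> e ` ?I)"
    using subtopology_Times[of "euclidean :: complex topology" "euclidean :: real topology" UNIV ?I]
      subtopology_Times[of "euclidean :: complex topology" "euclidean :: complex topology" UNIV "e ` ?I"]
    by (simp_all add: euclidean_product_topology)
  define Q where "Q = (\<lambda>(x, \<tau>). (T \<tau> x, e \<tau>))"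
  have Q: "quotient_map ?X ?Y Q"
  proof -
    have "quotient_map (top_of_set ?I) (top_of_set (e ` ?I)) e"
      using e(1) by (intro continuous_imp_quotient_map) (auto simp: compact_space_subtopology Hausdorff_space_subtopology)
    \<comment> \<open>The plane is locally compact, so taking the product with it preserves quotient maps.\<close>
    then have 1: "quotient_map ?X ?Y (\<lambda>(x, \<tau>). (x, e \<tau>))"
      by (intro quotient_map_prod_right) (auto simp: locally_compact_space_euclidean)
    have "homeomorphic_maps ?X ?X (\<lambda>(x, \<tau>). (T \<tau> x, \<tau>)) (\<lambda>(x, \<tau>). (T' \<tau> x, \<tau>))"
      unfolding X homeomorphic_maps_def case_prod_unfold
    proof (intro conjI)
      have "continuous_on (UNIV \<times> ?I) (\<lambda>a. T (snd a) (fst a))"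
        by (rule isotopy_on_continuous[OF T(1)]) (auto intro!: continuous_intros)
      then show "continuous_map (top_of_set (UNIV \<times> ?I)) (top_of_set (UNIV \<times> ?I)) (\<lambda>a. (T (snd a) (fst a), snd a))"
        by (auto simp: continuous_map_in_subtopology intro!: continuous_intros)
      have "continuous_on (UNIV \<times> ?I) (\<lambda>a. T' (snd a) (fst a))"
        by (rule isotopy_on_continuous[OF isotopy_on_sym[OF T(1)]]) (auto intro!: continuous_intros)
      then show "continuous_map (top_of_set (UNIV \<times> ?I)) (top_of_set (UNIV \<times> ?I)) (\<lambda>a. (T' (snd a) (fst a), snd a))"
        by (auto simp: continuous_map_in_subtopology intro!: continuous_intros)
    qed (use TT' in auto)
    then have "quotient_map ?X ?X (\<lambda>(x, \<tau>). (T \<tau> x, \<tau>))"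
      using homeomorphic_map_maps homeomorphic_map_def by blast
    from quotient_map_compose[OF this 1] show ?thesis
      by (simp add: Q_def o_def case_prod_unfold)
  qed
  have pre: "{x \<in> topspace ?X. Q x \<in> W} = (- B) \<times> ?I"
    using inW TB by (auto simp: Q_def)
  have "open (- B)" using assms(1) by (simp add: B_def finite_imp_closed open_Compl)
  then have "openin ?X ((- B) \<times> ?I)"
    by (auto simp: openin_prod_Times_iff)
  moreover have "W \<subseteq> topspace ?Y" by (auto simp: W_def)
  ultimately have "openin ?Y W"
    using Q[unfolded quotient_map_def, THEN conjunct2, rule_format, of W] unfolding pre by blast
  then have "quotient_map (subtopology ?X ((- B) \<times> ?I)) (subtopology ?Y W) Q"
    by (intro quotient_map_restriction[OF Q pre]) simp
  moreover have "subtopology ?X ((- B) \<times> ?I) = prod_topology F (top_of_set ?I)"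
    by (simp add: F_def subtopology_Times subtopology_subtopology)
  moreover have "subtopology ?Y W = top_of_set W"
    unfolding Y using \<open>W \<subseteq> topspace ?Y\<close> by (simp add: subtopology_subtopology Int_absorb1)
  ultimately have QW: "quotient_map (prod_topology F (top_of_set ?I)) (top_of_set W) Q"
    by simp
  have topF: "topspace F = - B" by (simp add: F_def)
  have "top_of_set W homeomorphic_space mapping_torus F \<psi>"
    unfolding mapping_torus_def
  proof (rule homeomorphic_glue_space[OF QW])
    have "inj_on \<psi> (topspace F)"
      using TT'(2)[of 1] by (metis \<psi>_def inj_onI atLeastAtMost_iff order_refl zero_le_one)
    note g = glue_equiv_mapping_torus[OF this]
    fix a b assume "a \<in> topspace (prod_topology F (top_of_set ?I))" "b \<in> topspace (prod_topology F (top_of_set ?I))"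
    then obtain x \<tau> y \<sigma> where ab: "a = (x, \<tau>)" "b = (y, \<sigma>)" "x \<in> - B" "y \<in> - B" "\<tau> \<in> ?I" "\<sigma> \<in> ?I"
      by (auto simp: topF)
    have "Q a = Q b \<longleftrightarrow> T \<tau> x = T \<sigma> y \<and> (\<tau> = \<sigma> \<or> \<tau> = 0 \<and> \<sigma> = 1 \<or> \<tau> = 1 \<and> \<sigma> = 0)"
      using e(2)[OF ab(5,6)] by (simp add: Q_def ab)
    also have "\<dots> \<longleftrightarrow> x = y \<and> \<tau> = \<sigma> \<or> \<tau> = 0 \<and> \<sigma> = 1 \<and> y = \<psi> x \<or> \<tau> = 1 \<and> \<sigma> = 0 \<and> x = \<psi> y"
      using TT'[OF ab(5)] TT'[of 1] T(2) unfolding \<psi>_def by (auto, metis+)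
    also have "\<dots> \<longleftrightarrow> (a, b) \<in> glue_equiv (prod_topology F (top_of_set ?I)) {((x, 0), (\<psi> x, 1)) | x. x \<in> topspace F}"
      unfolding g using ab by (auto simp: topF)
    finally show "Q a = Q b \<longleftrightarrow> (a, b) \<in> glue_equiv (prod_topology F (top_of_set ?I)) {((x, 0), (\<psi> x, 1)) | x. x \<in> topspace F}" .
  qed
  moreover have "homeomorphic_map F F \<psi>"
  proof -
    have "continuous_on UNIV (T 1)" "continuous_on UNIV \<psi>"
      using isotopy_on_continuous[OF T(1), of UNIV "\<lambda>_. 1" "\<lambda>x. x"]
        isotopy_on_continuous[OF isotopy_on_sym[OF T(1)], of UNIV "\<lambda>_. 1" "\<lambda>x. x"] by (auto simp: \<psi>_def)
    then have "homeomorphic_maps F F \<psi> (T 1)"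
      unfolding homeomorphic_maps_def F_def using TT'[of 1] \<psi>B T1B
      by (auto simp: continuous_map_in_subtopology \<psi>_def intro: continuous_on_subset)
    then show ?thesis by (auto simp: homeomorphic_map_maps)
  qed
  moreover have "orientation_preserving {(- B, id)} \<psi>"
  proof -
    have "sense_preserving_on (- B) \<psi>"
      using isotopy_on_winding_number[OF isotopy_on_sym[OF T(1)] T'0]
      by (simp add: sense_preserving_on_def \<psi>_def)
    moreover have "(id \<circ> \<psi> \<circ> inv_into (- B) id) z = \<psi> z" if "z \<in> - B" for z
      using inv_into_f_f[of id "- B" z] that by simp
    ultimately have "sense_preserving_on (- B) (id \<circ> \<psi> \<circ> inv_into (- B) id)"
      using sense_preserving_on_cong[of "- B"] by metis
    moreover have "id ` {x \<in> - B. \<psi> x \<in> - B} = - B" using \<psi>B by auto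
    ultimately show ?thesis unfolding orientation_preserving_def by auto
  qed
  moreover have "oriented_surface F {(- B, id)}"
    unfolding F_def using assms(1) by (intro oriented_surface_punctured_plane) (simp add: B_def)
  ultimately show ?thesis
    unfolding fibered_def W_def by blast
qed

section \<open>Links of circles in the boundary of the bidisc\<close>

text \<open>The boundary of the bidisc is a topological three-sphere. It is convenient because its two solid
  tori need no normalization of the coordinates.\<close>

definition bidisc_sphere :: "(complex \<times> complex) set" where
  "bidisc_sphere = {(z, w). max (cmod z) (cmod w) = 1}"

text \<open>For each \<open>\<mu>\<close> the two equations describe a real plane, the fixed points of a conjugate-linear
  involution. The exponent \<open>- B\<close> makes the involutions for all the roots of unity \<open>\<mu>\<close> elements of
  one dihedral group.\<close>

definition circle_link :: "int \<Rightarrow> int \<Rightarrow> (complex \<times> complex) set" where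
  "circle_link A B = {(z, w) \<in> bidisc_sphere.
     \<exists>\<mu>. \<mu> powi A = 1 \<and> z = \<mu> * cnj z \<and> w = \<mu> powi (- B) * cnj w}"

lemma finite_roots_of_unity_int: 
  fixes A :: int
  assumes "A \<noteq> 0" shows "finite {\<mu> :: complex. \<mu> powi A = 1}"
proof -
  have "\<mu> ^ nat \<bar>A\<bar> = 1" if "\<mu> powi A = 1" for \<mu> :: complex
    using that by (auto simp: power_int_def power_inverse abs_if split: if_splits)
  then have "{\<mu> :: complex. \<mu> powi A = 1} \<subseteq> {\<mu>. \<mu> ^ nat \<bar>A\<bar> = 1}" by blast
  moreover have "finite {\<mu> :: complex. \<mu> ^ nat \<bar>A\<bar> = 1}"
    using assms by (intro finite_roots_unity) auto
  ultimately show ?thesis by (rule finite_subset)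
qed

lemma norm_root_of_unity_int:
  assumes "(A :: int) \<noteq> 0" "\<mu> powi A = (1 :: complex)" shows "cmod \<mu> = 1"
proof -
  have "cmod \<mu> powi A = 1" using assms(2) by (metis norm_one norm_power_int)
  then have "cmod \<mu> ^ nat \<bar>A\<bar> = 1"
    by (auto simp: power_int_def power_inverse abs_if split: if_splits)
  moreover have "0 < nat \<bar>A\<bar>" using assms(1) by simp
  ultimately show ?thesis using power_eq_imp_eq_base[of "cmod \<mu>" "nat \<bar>A\<bar>" 1] by simp
qed

text \<open>Raising to the power \<open>B\<close> permutes the roots of unity, with inverse the power \<open>D\<close>.\<close>

lemma root_of_unity_inverse_exponent:
  assumes "A \<noteq> 0" "A dvd B * D - 1" "\<mu> powi A = (1 :: complex)"
  shows "\<mu> powi (B * D) = \<mu>"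
proof -
  obtain n where n: "B * D = 1 + A * n" using assms(2) by (auto simp: dvd_def algebra_simps)
  have "\<mu> \<noteq> 0" using norm_root_of_unity_int[OF assms(1,3)] by auto
  then show ?thesis using assms(3) by (simp add: n power_int_add power_int_mult)
qed

text \<open>On the unit circle this is the cotangent of half the argument: there the quotient is purely
  imaginary.\<close>

definition cayley :: "complex \<Rightarrow> real" where
  "cayley \<mu> = Im ((1 + \<mu>) / (1 - \<mu>))"

lemma cayley:
  assumes "cmod \<mu> = 1" "\<mu> \<noteq> 1"
  shows "1 + \<mu> = \<i> * cayley \<mu> * (1 - \<mu>)"
proof -
  have n: "Re \<mu> * Re \<mu> + Im \<mu> * Im \<mu> = 1"
    using assms(1) cmod_power2[of \<mu>] by (simp add: power2_eq_square)
  have "Re ((1 + \<mu>) / (1 - \<mu>)) = ((1 + Re \<mu>) * (1 - Re \<mu>) - Im \<mu> * Im \<mu>) / ((1 - Re \<mu>)\<^sup>2 + (Im \<mu>)\<^sup>2)"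
    by (simp add: Re_divide)
  also have "(1 + Re \<mu>) * (1 - Re \<mu>) - Im \<mu> * Im \<mu> = 0" using n by (simp add: algebra_simps)
  finally have "(1 + \<mu>) / (1 - \<mu>) = \<i> * cayley \<mu>"
    by (simp add: complex_eq_iff cayley_def)
  then show ?thesis using assms(2) by (simp add: field_simps)
qed

text \<open>The fixed points of \<open>z \<mapsto> \<mu> cnj z\<close> form the line whose angle is half the argument of \<open>\<mu>\<close>, and its
  inverse slope is the cotangent of that angle.\<close>

lemma cayley_fixed_line:
  assumes "cmod \<mu> = 1" "\<mu> \<noteq> 1"
  shows "z = \<mu> * cnj z \<longleftrightarrow> Re z = cayley \<mu> * Im z"
proof -
  have z: "z = Re z + \<i> * Im z" "cnj z = Re z - \<i> * Im z" by (simp_all add: complex_eq_iff)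
  have "z = \<mu> * cnj z \<longleftrightarrow> Re z + \<i> * Im z = \<mu> * (Re z - \<i> * Im z)"
    using z by metis
  also have "\<dots> \<longleftrightarrow> Re z * (1 - \<mu>) = - \<i> * Im z * (1 + \<mu>)"
    by (simp add: algebra_simps)
  also have "\<dots> \<longleftrightarrow> Re z * (1 - \<mu>) = (cayley \<mu> * Im z) * (1 - \<mu>)"
    unfolding cayley[OF assms] by (simp add: algebra_simps)
  also have "\<dots> \<longleftrightarrow> complex_of_real (Re z) = complex_of_real (cayley \<mu> * Im z)"
    using assms(2) by simp
  finally show ?thesis by (simp only: of_real_eq_iff)
qed

lemma cayley_inj:
  assumes "cmod \<mu> = 1" "\<mu> \<noteq> 1" "cmod \<nu> = 1" "\<nu> \<noteq> 1" "cayley \<mu> = cayley \<nu>"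
  shows "\<mu> = \<nu>"
proof -
  have "Complex (cayley \<mu>) 1 = \<mu> * cnj (Complex (cayley \<mu>) 1)"
    "Complex (cayley \<mu>) 1 = \<nu> * cnj (Complex (cayley \<mu>) 1)"
    using cayley_fixed_line[OF assms(1,2)] cayley_fixed_line[OF assms(3,4)] assms(5) by simp_all
  moreover have "cnj (Complex (cayley \<mu>) 1) \<noteq> 0" by (simp add: complex_eq_iff)
  ultimately show ?thesis by (metis mult_cancel_right)
qed

text \<open>The fibration is the direction of \<open>(Im z, Im w)\<close>, with axis the circle belonging to \<open>\<mu> = 1\<close>. The
  circle of any other \<open>\<mu>\<close> is given by \<open>Re z = l Im z\<close> and \<open>Re w = k Im w\<close> with cotangents \<open>l\<close> and \<open>k\<close>;
  hence in the fiber over \<open>(cos \<theta>, sin \<theta>)\<close> it is the single point \<open>(l cos \<theta>, k sin \<theta>)\<close>. The \<open>l\<close> of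
  distinct circles are distinct, and so are the \<open>k\<close>, because \<open>\<mu>\<close> can be recovered from its power
  \<open>- B\<close>.\<close>

lemma fibered_circle_link_complement:
  assumes A: "A \<noteq> 0" and D: "A dvd B * D - 1"
  shows "fibered (top_of_set (bidisc_sphere - circle_link A B))"
proof -
  define J where "J = {\<mu> :: complex. \<mu> powi A = 1 \<and> \<mu> \<noteq> 1}"
  define l where "l = cayley"
  define k where "k = (\<lambda>\<mu>. cayley (\<mu> powi (- B)))"
  \<comment> \<open>The angle starts at \<open>- pi/4\<close> to match the subdivision into quarters centred at multiples of
    \<open>pi/2\<close>.\<close>
  define \<theta> :: "real \<Rightarrow> real" where "\<theta> = (\<lambda>\<tau>. 2 * pi * \<tau> + (- (pi/4)))"
  define p where "p = (\<lambda>\<tau> \<mu>. Complex (l \<mu> * cos (\<theta> \<tau>)) (k \<mu> * sin (\<theta> \<tau>)))"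
  define e where "e = (\<lambda>\<tau>. cis (\<theta> \<tau>))"
  have J: "cmod \<mu> = 1" "\<mu> \<noteq> 1" "cmod (\<mu> powi (- B)) = 1" "\<mu> powi (- B) \<noteq> 1" if "\<mu> \<in> J" for \<mu>
  proof -
    show n: "cmod \<mu> = 1" using that norm_root_of_unity_int[OF A] by (auto simp: J_def)
    show "\<mu> \<noteq> 1" using that by (simp add: J_def)
    show "cmod (\<mu> powi (- B)) = 1" using n by (simp add: norm_power_int)
    show "\<mu> powi (- B) \<noteq> 1"
    proof
      assume "\<mu> powi (- B) = 1"
      then have "\<mu> powi B = 1" by (simp add: power_int_minus)
      then have "\<mu> powi (B * D) = 1" by (simp add: power_int_mult)
      then show False
        using that root_of_unity_inverse_exponent[OF A D, of \<mu>] by (simp add: J_def)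
    qed
  qed
  have finJ: "finite J"
    by (rule finite_subset[OF _ finite_roots_of_unity_int[OF A]]) (auto simp: J_def)
  have "inj_on l J" using J cayley_inj by (auto simp: inj_on_def l_def)
  have "inj_on k J"
  proof (rule inj_onI)
    fix \<mu> \<nu> assume \<mu>\<nu>: "\<mu> \<in> J" "\<nu> \<in> J" "k \<mu> = k \<nu>"
    then have "\<mu> powi (- B) = \<nu> powi (- B)" using J cayley_inj by (simp add: k_def)
    then have "\<mu> powi B = \<nu> powi B" by (simp add: power_int_minus)
    then have "\<mu> powi (B * D) = \<nu> powi (B * D)" by (simp add: power_int_mult)
    then show "\<mu> = \<nu>"
      using \<mu>\<nu> root_of_unity_inverse_exponent[OF A D] by (simp add: J_def)
  qed
  have "realizable_motion (2 * pi * 0 + - (pi/4)) (2 * pi * 1 + - (pi/4)) J (\<lambda>\<tau> \<mu>. Complex (l \<mu> * cos \<tau>) (k \<mu> * sin \<tau>))"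
    using realizable_motion_ellipses[OF finJ \<open>inj_on l J\<close> \<open>inj_on k J\<close>] by simp
  from realizable_motion_reparametrize[OF this] have "realizable_motion 0 1 J p"
    by (simp add: p_def \<theta>_def)
  moreover have "p 1 ` J = p 0 ` J"
    by (simp add: p_def \<theta>_def cos_diff sin_diff)
  moreover have "continuous_on {0..1} e"
    unfolding e_def \<theta>_def by (intro continuous_intros)
  moreover have "e \<tau> = e \<sigma> \<longleftrightarrow> \<tau> = \<sigma> \<or> \<tau> = 0 \<and> \<sigma> = 1 \<or> \<tau> = 1 \<and> \<sigma> = 0" if "\<tau> \<in> {0..1}" "\<sigma> \<in> {0..1}" for \<tau> \<sigma>
  proof -
    have "e \<tau> = e \<sigma> \<longleftrightarrow> (\<exists>n::int. \<theta> \<tau> = \<theta> \<sigma> + 2 * pi * n)"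
      using sin_cos_eq_iff[of "\<theta> \<tau>" "\<theta> \<sigma>"] by (auto simp: e_def complex_eq_iff)
    also have "\<dots> \<longleftrightarrow> (\<exists>n::int. \<tau> = \<sigma> + n)"
    proof -
      have "\<theta> \<tau> = \<theta> \<sigma> + 2 * pi * n \<longleftrightarrow> (2 * pi) * \<tau> = (2 * pi) * (\<sigma> + of_int n)" for n :: int
        unfolding \<theta>_def by (simp add: algebra_simps)
      then show ?thesis by simp
    qed
    also have "\<dots> \<longleftrightarrow> \<tau> = \<sigma> \<or> \<tau> = 0 \<and> \<sigma> = 1 \<or> \<tau> = 1 \<and> \<sigma> = 0"
    proof
      assume "\<exists>n::int. \<tau> = \<sigma> + n"
      then obtain n :: int where n: "\<tau> = \<sigma> + n" by blast
      then have "-1 \<le> real_of_int n" "real_of_int n \<le> 1" using that by auto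
      then have "n = -1 \<or> n = 0 \<or> n = 1" by linarith
      then show "\<tau> = \<sigma> \<or> \<tau> = 0 \<and> \<sigma> = 1 \<or> \<tau> = 1 \<and> \<sigma> = 0" using n that by auto
    next
      assume "\<tau> = \<sigma> \<or> \<tau> = 0 \<and> \<sigma> = 1 \<or> \<tau> = 1 \<and> \<sigma> = 0"
      then have "\<tau> = \<sigma> + of_int 0 \<or> \<tau> = \<sigma> + of_int (-1) \<or> \<tau> = \<sigma> + of_int 1" by auto
      then show "\<exists>n::int. \<tau> = \<sigma> + n" by blast
    qed
    finally show ?thesis .
  qed
  ultimately have fib: "fibered (top_of_set {(z, e \<tau>) | z \<tau>. \<tau> \<in> {0..1} \<and> z \<notin> p \<tau> ` J})" (is "fibered (top_of_set ?W)")
    using finJ by (intro fibered_motion_complement) auto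

  define M :: "complex \<times> complex \<Rightarrow> real" where "M = (\<lambda>x. max (cmod (fst x)) (cmod (snd x)))"
  \<comment> \<open>The linear involution \<open>sw\<close> separates real parts from imaginary parts. Up to the scaling that
    moves between the boundary of the bidisc and the product of the plane with the unit circle, it is
    the homeomorphism in both directions.\<close>
  define sw :: "complex \<times> complex \<Rightarrow> complex \<times> complex" where
    "sw = (\<lambda>x. (Complex (Re (fst x)) (Re (snd x)), Complex (Im (fst x)) (Im (snd x))))"
  have swsw: "sw (sw x) = x" for x by (simp add: sw_def)
  have sw_scale: "sw (s *\<^sub>R x) = s *\<^sub>R sw x" for s x by (simp add: sw_def complex_eq_iff)
  have M_scale: "M (s *\<^sub>R x) = s * M x" if "0 \<le> s" for s x
    using that by (simp add: M_def max_mult_distrib_left)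
  have M_pos: "0 < M x" if "snd (sw x) \<noteq> 0" for x
    using that by (auto simp: M_def sw_def complex_eq_iff less_max_iff_disj)
  have "continuous_on UNIV sw" unfolding sw_def Complex_eq by (intro continuous_intros)
  then have sw_cont: "continuous_on X (\<lambda>x. sw x)" for X by (rule continuous_on_subset) simp
  have M_cont: "continuous_on X M" for X unfolding M_def by (intro continuous_intros)
  define on_link_plane where "on_link_plane = (\<lambda>x. \<exists>\<mu>\<in>J. Re (fst x) = l \<mu> * Im (fst x) \<and> Re (snd x) = k \<mu> * Im (snd x))"
  have on_link_plane_scale: "on_link_plane (s *\<^sub>R x) \<longleftrightarrow> on_link_plane x" if "s \<noteq> 0" for s x
    using that by (simp add: on_link_plane_def mult.left_commute[of _ s])
  have link: "x \<in> bidisc_sphere - circle_link A B \<longleftrightarrow> M x = 1 \<and> snd (sw x) \<noteq> 0 \<and> \<not> on_link_plane x" for x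
  proof -
    obtain z w where x: "x = (z, w)" by (cases x)
    have "(\<exists>\<mu>. \<mu> powi A = 1 \<and> z = \<mu> * cnj z \<and> w = \<mu> powi (- B) * cnj w) \<longleftrightarrow>
      (z = cnj z \<and> w = cnj w) \<or> (\<exists>\<mu>\<in>J. z = \<mu> * cnj z \<and> w = \<mu> powi (- B) * cnj w)"
      (is "(\<exists>\<mu>. ?f \<mu>) \<longleftrightarrow> ?g \<or> ?h")
    proof
      assume "\<exists>\<mu>. ?f \<mu>"
      then obtain \<mu> where "?f \<mu>" by blast
      then show "?g \<or> ?h" by (cases "\<mu> = 1") (auto simp: J_def)
    next
      assume "?g \<or> ?h"
      moreover have "?g \<Longrightarrow> ?f 1" by simp
      ultimately show "\<exists>\<mu>. ?f \<mu>" unfolding J_def by blast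
    qed
    also have "(z = cnj z \<and> w = cnj w) \<longleftrightarrow> snd (sw x) = 0"
      by (auto simp: complex_eq_iff sw_def x)
    also have "(\<exists>\<mu>\<in>J. z = \<mu> * cnj z \<and> w = \<mu> powi (- B) * cnj w) \<longleftrightarrow> on_link_plane x"
      unfolding on_link_plane_def l_def k_def x fst_conv snd_conv
    proof (intro bex_cong refl)
      fix \<mu> assume \<mu>: "\<mu> \<in> J"
      show "(z = \<mu> * cnj z \<and> w = \<mu> powi (- B) * cnj w) = (Re z = cayley \<mu> * Im z \<and> Re w = cayley (\<mu> powi (- B)) * Im w)"
        by (simp only: cayley_fixed_line[OF J(1,2)[OF \<mu>]] cayley_fixed_line[OF J(3,4)[OF \<mu>]])
    qed
    finally show ?thesis by (auto simp: circle_link_def bidisc_sphere_def x M_def)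
  qed
  have W: "y \<in> ?W \<longleftrightarrow> cmod (snd y) = 1 \<and> \<not> on_link_plane (sw y)" for y
  proof -
    obtain P u where y: "y = (P, u)" by (cases y)
    have 1: "P \<in> p \<tau> ` J \<longleftrightarrow> on_link_plane (sw (P, e \<tau>))" for \<tau>
      by (auto simp: on_link_plane_def sw_def p_def e_def complex_eq_iff image_iff)
    have 2: "\<exists>\<tau>\<in>{0..1}. u = e \<tau>" if u: "cmod u = 1"
    proof -
      have "cmod (u * cis (pi/4)) = 1" using u by (simp add: norm_mult)
      then have "(Re (u * cis (pi/4)))\<^sup>2 + (Im (u * cis (pi/4)))\<^sup>2 = 1" using cmod_power2 by (metis one_power2)
      then obtain t where t: "0 \<le> t" "t < 2 * pi" "Re (u * cis (pi/4)) = cos t" "Im (u * cis (pi/4)) = sin t"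
        using sincos_total_2pi by metis
      then have "u * cis (pi/4) = cis t" by (simp add: complex_eq_iff)
      then have "u * cis (pi/4) * cis (- (pi/4)) = cis t * cis (- (pi/4))" by simp
      then have "u = cis (t + - (pi/4))" by (simp only: cis_mult mult.assoc) simp
      also have "\<dots> = e (t / (2 * pi))" by (simp add: e_def \<theta>_def)
      finally show ?thesis using t by (intro bexI[of _ "t / (2 * pi)"]) (auto simp: field_simps)
    qed
    have "(P, u) \<in> ?W \<longleftrightarrow> (\<exists>\<tau>\<in>{0..1}. u = e \<tau> \<and> P \<notin> p \<tau> ` J)" by blast
    also have "\<dots> \<longleftrightarrow> (\<exists>\<tau>\<in>{0..1}. u = e \<tau>) \<and> \<not> on_link_plane (sw (P, u))"
      unfolding 1 by auto
    also have "(\<exists>\<tau>\<in>{0..1}. u = e \<tau>) \<longleftrightarrow> cmod u = 1"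
      using 2 by (auto simp: e_def)
    finally show ?thesis by (simp add: y)
  qed
  have "homeomorphic_maps (top_of_set (bidisc_sphere - circle_link A B)) (top_of_set ?W)
    (\<lambda>x. (1 / cmod (snd (sw x))) *\<^sub>R sw x) (\<lambda>y. (1 / M (sw y)) *\<^sub>R sw y)"
    (is "homeomorphic_maps _ _ ?g ?h")
  proof -
    have gW: "?g x \<in> ?W" if "x \<in> bidisc_sphere - circle_link A B" for x
      using that unfolding link W sw_scale swsw by (simp add: on_link_plane_scale)
    have snd_sw_sw: "snd (sw (sw y)) \<noteq> 0" if "y \<in> ?W" for y
      using that unfolding W swsw by auto
    have hS: "?h y \<in> bidisc_sphere - circle_link A B" if y: "y \<in> ?W" for y
    proof -
      have m: "0 < M (sw y)" by (rule M_pos[OF snd_sw_sw[OF y]])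
      then show ?thesis using y unfolding link W sw_scale swsw by (auto simp: on_link_plane_scale M_scale)
    qed
    have hg: "?h (?g x) = x" if "x \<in> bidisc_sphere - circle_link A B" for x
      using that unfolding link sw_scale swsw by (simp add: M_scale)
    have gh: "?g (?h y) = y" if y: "y \<in> ?W" for y
    proof -
      have m: "0 < M (sw y)" by (rule M_pos[OF snd_sw_sw[OF y]])
      then show ?thesis using y unfolding W sw_scale swsw by simp
    qed
    have "continuous_on (bidisc_sphere - circle_link A B) ?g"
      using link by (intro continuous_intros sw_cont) auto
    moreover have "continuous_on ?W ?h"
      using M_pos[OF snd_sw_sw]
      by (intro continuous_intros sw_cont continuous_on_compose2[OF M_cont]) (auto simp: less_le)
    ultimately show ?thesis
      unfolding homeomorphic_maps_def using gW hS hg gh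
      by (auto simp: continuous_map_in_subtopology)
  qed
  then show ?thesis
    using fib homeomorphic_fibered unfolding homeomorphic_space_def by blast
qed

section \<open>Folding a solid torus onto the tangle ball\<close>

text \<open>Here \<open>a\<close> runs around the core circle of the solid torus and \<open>d\<close> over the meridian disk. On the
  boundary, \<open>cmod d = 1\<close>, the factor \<open>(1 + (cmod d)\<^sup>2) / 2\<close> is \<open>1\<close> and the map is the parametrization
  of the pillowcase. In the interior the factor spreads out the disks over \<open>a = 1\<close> and \<open>a = -1\<close>, which
  conjugation folds in half, and it bends their diameters of real points into the two vertical
  arcs.\<close>

definition solid_fold :: "complex \<times> complex \<Rightarrow> real \<times> real \<times> real" where
  "solid_fold = (\<lambda>(a, d). (Re a * (1 + (cmod d)\<^sup>2) / 2, Re d, Im a * Im d))"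

definition solid_torus :: "(complex \<times> complex) set" where
  "solid_torus = {(a, d). cmod a = 1 \<and> cmod d \<le> 1}"

lemma continuous_on_solid_fold: "continuous_on X solid_fold"
  unfolding solid_fold_def case_prod_unfold by (intro continuous_intros) auto

lemma solid_fold_cis: "solid_fold (cis (pi * x), cis (pi * y)) = pillow_map (x, y)"
  by (simp add: solid_fold_def pillow_map_def)

text \<open>If \<open>c\<^sup>2\<close> grows, then equality in \<open>u\<close> forces \<open>y\<^sup>2\<close> to decrease, while \<open>s\<^sup>2\<close> decreases with \<open>c\<^sup>2\<close>; so
  the product \<open>s\<^sup>2 y\<^sup>2\<close> cannot stay the same.\<close>

lemma solid_fold_profile_inj:
  fixes c s y :: real
  assumes 1: "c\<^sup>2 + s\<^sup>2 = 1" and 2: "c'\<^sup>2 + s'\<^sup>2 = 1"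
    and u: "c * (1 + v\<^sup>2 + y\<^sup>2) = c' * (1 + v\<^sup>2 + y'\<^sup>2)" and w: "s * y = s' * y'"
  shows "\<not> c\<^sup>2 < c'\<^sup>2"
proof
  assume less: "c\<^sup>2 < c'\<^sup>2"
  let ?m = "1 + v\<^sup>2 + y\<^sup>2" and ?n = "1 + v\<^sup>2 + y'\<^sup>2"
  have pos: "0 < ?m" "0 < ?n" by (simp_all add: add_pos_nonneg)
  have u2: "c\<^sup>2 * ?m\<^sup>2 = c'\<^sup>2 * ?n\<^sup>2" using u by (metis power_mult_distrib)
  have w2: "s\<^sup>2 * y\<^sup>2 = s'\<^sup>2 * y'\<^sup>2" using w by (metis power_mult_distrib)
  have "?n\<^sup>2 < ?m\<^sup>2"
  proof (rule ccontr)
    assume "\<not> ?n\<^sup>2 < ?m\<^sup>2"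
    then have "c\<^sup>2 * ?m\<^sup>2 \<le> c\<^sup>2 * ?n\<^sup>2" by (intro mult_left_mono) (simp_all only: not_less zero_le_power2)
    also have "\<dots> < c'\<^sup>2 * ?n\<^sup>2" using less pos by (intro mult_strict_right_mono) auto
    finally show False using u2 by simp
  qed
  then have "?n < ?m" using pos by (meson less_imp_le power_less_imp_less_base)
  then have y: "y'\<^sup>2 < y\<^sup>2" by simp
  have "s'\<^sup>2 * y'\<^sup>2 \<le> s\<^sup>2 * y'\<^sup>2" using less 1 2 by (intro mult_right_mono) auto
  also have "\<dots> < s\<^sup>2 * y\<^sup>2"
    using y less 1 2 zero_le_power2[of s'] by (intro mult_strict_left_mono) linarith+
  finally show False using w2 by simp
qed

text \<open>The image determines the squares of the real and imaginary parts by \<open>solid_fold_profile_inj\<close>. The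
  sign of \<open>Re a\<close> and the product \<open>Im a * Im d\<close> are then also known, which leaves only a simultaneous
  change of sign of the imaginary parts.\<close>

lemma solid_fold_eq_iff:
  assumes "cmod a = 1" "cmod a' = 1"
  shows "solid_fold (a, d) = solid_fold (a', d') \<longleftrightarrow> a' = a \<and> d' = d \<or> a' = cnj a \<and> d' = cnj d"
proof
  assume eq: "solid_fold (a, d) = solid_fold (a', d')"
  obtain c s c' s' v y v' y' where co: "a = Complex c s" "a' = Complex c' s'" "d = Complex v y" "d' = Complex v' y'"
    by (metis complex_surj)
  have 1: "c\<^sup>2 + s\<^sup>2 = 1" "c'\<^sup>2 + s'\<^sup>2 = 1"
    using assms cmod_power2[of a] cmod_power2[of a'] by (simp_all add: co)
  have v: "v' = v" and w: "s * y = s' * y'" using eq by (simp_all add: solid_fold_def co)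
  have u: "c * (1 + v\<^sup>2 + y\<^sup>2) = c' * (1 + v\<^sup>2 + y'\<^sup>2)"
    using eq by (simp add: solid_fold_def co cmod_power2 v add.assoc)
  have k: "c\<^sup>2 = c'\<^sup>2"
    using solid_fold_profile_inj[OF 1 u w] solid_fold_profile_inj[OF 1(2,1) u[symmetric] w[symmetric]] by linarith
  then have s2: "s\<^sup>2 = s'\<^sup>2" using 1 by linarith
  have pos: "0 < 1 + v\<^sup>2 + y\<^sup>2" "0 < 1 + v\<^sup>2 + y'\<^sup>2" by (simp_all add: add_pos_nonneg)
  have y2: "y\<^sup>2 = y'\<^sup>2"
  proof (cases "c = 0")
    case True
    then have "s\<^sup>2 = 1" "s'\<^sup>2 = 1" using 1 k by auto
    moreover have "s\<^sup>2 * y\<^sup>2 = s'\<^sup>2 * y'\<^sup>2" using w by (metis power_mult_distrib)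
    ultimately show ?thesis by simp
  next
    case False
    have "c\<^sup>2 * (1 + v\<^sup>2 + y\<^sup>2)\<^sup>2 = c\<^sup>2 * (1 + v\<^sup>2 + y'\<^sup>2)\<^sup>2"
      using u k by (metis power_mult_distrib)
    then have "(1 + v\<^sup>2 + y\<^sup>2)\<^sup>2 = (1 + v\<^sup>2 + y'\<^sup>2)\<^sup>2" using False by (simp only: mult_cancel_left) simp
    then have "1 + v\<^sup>2 + y\<^sup>2 = 1 + v\<^sup>2 + y'\<^sup>2"
      by (rule power2_eq_imp_eq) (use pos in linarith)+
    then show ?thesis by simp
  qed
  have c: "c' = c" using u pos unfolding y2 by simp
  have "s' = s \<or> s' = - s" "y' = y \<or> y' = - y" using s2 y2 by (auto simp: power2_eq_iff)
  then show "a' = a \<and> d' = d \<or> a' = cnj a \<and> d' = cnj d"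
    using w by (auto simp: co c v complex_eq_iff)
next
  assume "a' = a \<and> d' = d \<or> a' = cnj a \<and> d' = cnj d"
  then show "solid_fold (a, d) = solid_fold (a', d')" by (auto simp: solid_fold_def)
qed

lemma solid_fold_bounds:
  assumes a: "cmod a = 1" and d: "cmod d \<le> 1"
  defines "u \<equiv> Re a * (1 + (cmod d)\<^sup>2) / 2" and "v \<equiv> Re d" and "w \<equiv> Im a * Im d"
  shows "u\<^sup>2 \<le> 1" "v\<^sup>2 \<le> 1" "w\<^sup>2 \<le> (1 - u\<^sup>2) * (1 - v\<^sup>2)"
    and "w\<^sup>2 = (1 - u\<^sup>2) * (1 - v\<^sup>2) \<longleftrightarrow> cmod d = 1"
proof -
  have a2: "(Im a)\<^sup>2 = 1 - (Re a)\<^sup>2" using a cmod_power2[of a] by simp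
  have d2: "(Im d)\<^sup>2 = (cmod d)\<^sup>2 - v\<^sup>2" using cmod_power2[of d] by (simp add: v_def)
  have r: "(cmod d)\<^sup>2 \<le> 1" using d by (simp add: power_le_one)
  have w2: "w\<^sup>2 = (1 - (Re a)\<^sup>2) * ((cmod d)\<^sup>2 - v\<^sup>2)" by (simp add: w_def power_mult_distrib a2 d2)
  have half: "((1 + (cmod d)\<^sup>2) / 2)\<^sup>2 \<le> 1" using r by (simp add: power_le_one)
  have "u\<^sup>2 = (Re a)\<^sup>2 * ((1 + (cmod d)\<^sup>2) / 2)\<^sup>2" by (simp add: u_def power_mult_distrib power_divide)
  also have "\<dots> \<le> (Re a)\<^sup>2 * 1" using half by (intro mult_left_mono) auto
  finally have u2: "u\<^sup>2 \<le> (Re a)\<^sup>2" by simp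
  have ra: "(Re a)\<^sup>2 \<le> 1" using a2 zero_le_power2[of "Im a"] by linarith
  then show u1: "u\<^sup>2 \<le> 1" using u2 by linarith
  show v1: "v\<^sup>2 \<le> 1" using d2 r zero_le_power2[of "Im d"] by linarith
  have Y: "0 \<le> (cmod d)\<^sup>2 - v\<^sup>2" using d2 zero_le_power2[of "Im d"] by linarith
  have i1: "(1 - (Re a)\<^sup>2) * ((cmod d)\<^sup>2 - v\<^sup>2) \<le> (1 - u\<^sup>2) * ((cmod d)\<^sup>2 - v\<^sup>2)"
    using u2 Y by (intro mult_right_mono) auto
  have i2: "(1 - u\<^sup>2) * ((cmod d)\<^sup>2 - v\<^sup>2) \<le> (1 - u\<^sup>2) * (1 - v\<^sup>2)"
    using u1 r by (intro mult_left_mono) auto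
  show "w\<^sup>2 \<le> (1 - u\<^sup>2) * (1 - v\<^sup>2)" using i1 i2 w2 by linarith
  show "w\<^sup>2 = (1 - u\<^sup>2) * (1 - v\<^sup>2) \<longleftrightarrow> cmod d = 1"
  proof
    assume "cmod d = 1"
    then show "w\<^sup>2 = (1 - u\<^sup>2) * (1 - v\<^sup>2)" by (simp add: w2 u_def)
  next
    assume eq: "w\<^sup>2 = (1 - u\<^sup>2) * (1 - v\<^sup>2)"
    show "cmod d = 1"
    proof (rule ccontr)
      assume "cmod d \<noteq> 1"
      then have r1: "(cmod d)\<^sup>2 < 1" using d by (simp add: abs_square_less_1)
      have "((1 + (cmod d)\<^sup>2) / 2)\<^sup>2 < 1" using r1 by (simp add: abs_square_less_1)
      have "u\<^sup>2 < 1"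
      proof (cases "Re a = 0")
        case False
        then have "(Re a)\<^sup>2 * ((1 + (cmod d)\<^sup>2) / 2)\<^sup>2 < (Re a)\<^sup>2 * 1"
          using \<open>((1 + (cmod d)\<^sup>2) / 2)\<^sup>2 < 1\<close> by (intro mult_strict_left_mono) auto
        then show ?thesis using ra \<open>u\<^sup>2 = _\<close> by linarith
      qed (simp add: u_def)
      then have "(1 - u\<^sup>2) * ((cmod d)\<^sup>2 - v\<^sup>2) < (1 - u\<^sup>2) * (1 - v\<^sup>2)"
        using r1 by (intro mult_strict_left_mono) auto
      then show False using i1 w2 eq by linarith
    qed
  qed
qed

lemma solid_fold_frontier:
  assumes "cmod a = 1" "cmod d \<le> 1"
  shows "solid_fold (a, d) \<in> frontier tangle_ball \<longleftrightarrow> cmod d = 1"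
  using solid_fold_bounds[OF assms]
  by (simp add: frontier_tangle_ball solid_fold_def abs_square_le_1)

text \<open>For given \<open>(u, v, w)\<close> the square \<open>Y\<close> of \<open>Im d\<close> determines \<open>(Re a)\<^sup>2\<close> through \<open>u\<close>. The remaining
  equation for \<open>w\<^sup>2\<close> is solved by the intermediate value theorem between \<open>Y = 0\<close> and the boundary value
  \<open>Y = 1 - v\<^sup>2\<close>. A positive value of \<open>w\<^sup>2\<close> excludes \<open>(Re a)\<^sup>2 > 1\<close>; for \<open>w = 0\<close> the solution is explicit.\<close>

lemma solid_fold_image: "solid_fold ` solid_torus = tangle_ball"
proof
  show "solid_fold ` solid_torus \<subseteq> tangle_ball"
  proof (rule image_subsetI)
    fix x assume x: "x \<in> solid_torus"
    obtain a d where ad: "x = (a, d)" by (cases x)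
    show "solid_fold x \<in> tangle_ball"
      using x solid_fold_bounds[of a d]
      by (simp add: ad solid_torus_def tangle_ball_def solid_fold_def abs_square_le_1)
  qed
  show "tangle_ball \<subseteq> solid_fold ` solid_torus"
  proof clarify
    fix u v w assume "(u, v, w) \<in> tangle_ball"
    then have uv: "u\<^sup>2 \<le> 1" "v\<^sup>2 \<le> 1" and w: "w\<^sup>2 \<le> (1 - u\<^sup>2) * (1 - v\<^sup>2)"
      by (auto simp: tangle_ball_def abs_square_le_1)
    let ?k = "\<lambda>Y. (2 * u / (1 + v\<^sup>2 + Y))\<^sup>2"
    have pos: "0 < 1 + v\<^sup>2 + Y" if "0 \<le> Y" for Y using that by (simp add: add_pos_nonneg)
    obtain Y where Y: "0 \<le> Y" "Y \<le> 1 - v\<^sup>2" and k: "?k Y \<le> 1" and wY: "(1 - ?k Y) * Y = w\<^sup>2"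
    proof (cases "w = 0")
      case True
      define Y where "Y = max 0 (2 * \<bar>u\<bar> - 1 - v\<^sup>2)"
      have Y: "0 \<le> Y" "Y \<le> 1 - v\<^sup>2" using uv by (auto simp: Y_def abs_square_le_1)
      have "2 * \<bar>u\<bar> \<le> 1 + v\<^sup>2 + Y" by (simp add: Y_def)
      then have "\<bar>2 * u / (1 + v\<^sup>2 + Y)\<bar> \<le> 1" using pos[OF Y(1)] by (simp add: abs_mult)
      then have "?k Y \<le> 1" by (simp only: abs_square_le_1)
      moreover have "(1 - ?k Y) * Y = w\<^sup>2"
      proof (cases "Y = 0")
        case False
        then have "1 + v\<^sup>2 + Y = 2 * \<bar>u\<bar>" by (auto simp: Y_def max_def split: if_splits)
        moreover from this have "u \<noteq> 0" using pos[OF Y(1)] by auto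
        ultimately show ?thesis using True by (simp add: power_divide)
      qed (simp add: True)
      ultimately show ?thesis using that[OF Y] by blast
    next
      case False
      have "\<exists>Y\<ge>0. Y \<le> 1 - v\<^sup>2 \<and> (1 - ?k Y) * Y = w\<^sup>2"
      proof (rule IVT')
        show "(1 - ?k 0) * 0 \<le> w\<^sup>2" "0 \<le> 1 - v\<^sup>2" using uv by auto
        show "w\<^sup>2 \<le> (1 - ?k (1 - v\<^sup>2)) * (1 - v\<^sup>2)" using w by (simp add: power_divide)
        show "continuous_on {0..1 - v\<^sup>2} (\<lambda>Y. (1 - ?k Y) * Y)"
          using pos by (intro continuous_intros) force
      qed
      then obtain Y where Y: "0 \<le> Y" "Y \<le> 1 - v\<^sup>2" "(1 - ?k Y) * Y = w\<^sup>2" by blast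
      then have "0 < (1 - ?k Y) * Y" using False by simp
      then have "?k Y \<le> 1" using Y(1) by (simp add: zero_less_mult_iff)
      then show ?thesis using that Y by blast
    qed
    define c where "c = 2 * u / (1 + v\<^sup>2 + Y)"
    define s where "s = sqrt (1 - ?k Y)"
    define y where "y = (if 0 \<le> w then sqrt Y else - sqrt Y)"
    have s2: "s\<^sup>2 = 1 - c\<^sup>2" using k by (simp add: s_def c_def)
    have y2: "y\<^sup>2 = Y" using Y by (simp add: y_def)
    have "sqrt ((1 - ?k Y) * Y) = \<bar>w\<bar>" unfolding wY by simp
    then have sy: "s * y = w" by (simp add: s_def y_def real_sqrt_mult split: if_splits)
    have "cmod (Complex c s) = 1" by (simp add: cmod_def s2)
    moreover have "(cmod (Complex v y))\<^sup>2 = v\<^sup>2 + Y" by (simp add: cmod_power2 y2)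
    moreover from this have "cmod (Complex v y) \<le> 1" using Y(2) by (simp add: cmod_def y2)
    moreover have "c * (1 + (v\<^sup>2 + Y)) / 2 = u" using pos[OF Y(1)] by (simp add: c_def add.assoc)
    ultimately show "(u, v, w) \<in> solid_fold ` solid_torus"
      by (intro image_eqI[of _ _ "(Complex c s, Complex v y)"]) (simp_all add: solid_fold_def solid_torus_def sy)
  qed
qed

text \<open>If \<open>w = 0\<close>, then \<open>a\<close> or \<open>d\<close> is real, and the equation of the arcs forces the other one to be
  real as well.\<close>

lemma solid_fold_vertical_arcs:
  assumes "cmod a = 1" "cmod d \<le> 1"
  shows "solid_fold (a, d) \<in> vertical_arcs \<longleftrightarrow> a = cnj a \<and> d = cnj d"
proof -
  have a2: "(Re a)\<^sup>2 + (Im a)\<^sup>2 = 1" using assms(1) cmod_power2[of a] by simp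
  have d2: "(cmod d)\<^sup>2 = (Re d)\<^sup>2 + (Im d)\<^sup>2" by (rule cmod_power2)
  have v: "\<bar>Re d\<bar> \<le> 1" using assms(2) abs_Re_le_cmod[of d] by linarith
  have "solid_fold (a, d) \<in> vertical_arcs \<longleftrightarrow> Im a * Im d = 0 \<and> \<bar>Re a\<bar> * (1 + (cmod d)\<^sup>2) = 1 + (Re d)\<^sup>2"
    using v by (auto simp: vertical_arcs_def solid_fold_def abs_mult)
  also have "\<dots> \<longleftrightarrow> Im a = 0 \<and> Im d = 0"
  proof
    assume H: "Im a * Im d = 0 \<and> \<bar>Re a\<bar> * (1 + (cmod d)\<^sup>2) = 1 + (Re d)\<^sup>2"
    have p: "1 + (Re d)\<^sup>2 \<noteq> 0" by (simp add: add_pos_nonneg less_imp_neq[symmetric])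
    show "Im a = 0 \<and> Im d = 0"
    proof (cases "Im a = 0")
      case True
      then have "\<bar>Re a\<bar> = 1" using a2 by (simp add: power2_eq_1_iff) auto
      then show ?thesis using H True d2 by simp
    next
      case False
      then have "Im d = 0" using H by simp
      then have "\<bar>Re a\<bar> = 1" using H d2 p by simp
      then have "(Re a)\<^sup>2 = 1" by (metis power2_abs one_power2)
      then show ?thesis using a2 False by simp
    qed
  next
    assume H: "Im a = 0 \<and> Im d = 0"
    then have "\<bar>Re a\<bar> = 1" using a2 by (simp add: power2_eq_1_iff) auto
    then show "Im a * Im d = 0 \<and> \<bar>Re a\<bar> * (1 + (cmod d)\<^sup>2) = 1 + (Re d)\<^sup>2" using H d2 by simp
  qed
  also have "\<dots> \<longleftrightarrow> a = cnj a \<and> d = cnj d" by (simp add: complex_eq_iff)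
  finally show ?thesis .
qed

section \<open>The dihedral quotient of the boundary of the bidisc\<close>

lemma compact_space_sum_topology:
  assumes "finite I" "\<And>i. i \<in> I \<Longrightarrow> compact_space (X i)"
  shows "compact_space (sum_topology X I)"
proof -
  have "compactin (sum_topology X I) (Pair i ` topspace (X i))" if "i \<in> I" for i
    using that assms(2) continuous_map_component_injection[of i I X]
    by (intro image_compactin) (auto simp: compact_space_def)
  then have "compactin (sum_topology X I) (\<Union>i\<in>I. Pair i ` topspace (X i))"
    using assms(1) by (intro compactin_Union) auto
  moreover have "(\<Union>i\<in>I. Pair i ` topspace (X i)) = topspace (sum_topology X I)" by auto
  ultimately show ?thesis by (simp add: compact_space_def)
qed

lemma continuous_map_from_sum_topology:
  assumes "\<And>i. i \<in> I \<Longrightarrow> continuous_map (X i) Y (\<lambda>x. f (i, x))"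
  shows "continuous_map (sum_topology X I) Y f"
  unfolding continuous_map_def
proof (intro conjI allI impI)
  show "f \<in> topspace (sum_topology X I) \<rightarrow> topspace Y"
    using assms unfolding continuous_map_def by auto blast
  fix U assume "openin Y U"
  then have "openin (X i) {x \<in> topspace (X i). f (i, x) \<in> U}" if "i \<in> I" for i
    using assms[OF that] by (simp add: continuous_map_def)
  then show "openin (sum_topology X I) {x \<in> topspace (sum_topology X I). f x \<in> U}"
    by (auto simp: openin_sum_topology)
qed

lemma quotient_map_sum_topology:
  assumes f: "\<And>i. i \<in> I \<Longrightarrow> quotient_map (X i) (Y i) (f i)"
  shows "quotient_map (sum_topology X I) (sum_topology Y I) (\<lambda>(i, x). (i, f i x))"
  unfolding quotient_map_def
proof (intro conjI allI impI)
  have "f i ` topspace (X i) = topspace (Y i)" if "i \<in> I" for i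
    using f[OF that] by (rule quotient_imp_surjective_map)
  then show "(\<lambda>(i, x). (i, f i x)) ` topspace (sum_topology X I) = topspace (sum_topology Y I)"
    by (force simp: image_iff)
  fix U assume U: "U \<subseteq> topspace (sum_topology Y I)"
  have "openin (X i) {x. (i, x) \<in> {z \<in> topspace (sum_topology X I). (case z of (i, x) \<Rightarrow> (i, f i x)) \<in> U}} \<longleftrightarrow>
      openin (Y i) {y. (i, y) \<in> U}" if i: "i \<in> I" for i
  proof -
    have "{y. (i, y) \<in> U} \<subseteq> topspace (Y i)" using U by auto
    then have "openin (X i) {x \<in> topspace (X i). f i x \<in> {y. (i, y) \<in> U}} \<longleftrightarrow> openin (Y i) {y. (i, y) \<in> U}"
      using f[OF i] unfolding quotient_map_def by blast
    moreover have "{x. (i, x) \<in> {z \<in> topspace (sum_topology X I). (case z of (i, x) \<Rightarrow> (i, f i x)) \<in> U}} =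
        {x \<in> topspace (X i). f i x \<in> {y. (i, y) \<in> U}}" using i by auto
    ultimately show ?thesis by simp
  qed
  then show "openin (sum_topology X I) {z \<in> topspace (sum_topology X I). (case z of (i, x) \<Rightarrow> (i, f i x)) \<in> U} \<longleftrightarrow>
      openin (sum_topology Y I) U"
    unfolding openin_sum_topology using U by (auto simp del: mem_Collect_eq)
qed

text \<open>The map \<open>(z, w) \<mapsto> (z\<^sup>A, w z\<^sup>B)\<close> is an unbranched self-covering of the solid torus with \<open>\<bar>A\<bar>\<close>
  sheets, and \<open>B\<close> prescribes how the meridian disks are twisted.\<close>

definition wrapped_fold :: "int \<Rightarrow> int \<Rightarrow> complex \<times> complex \<Rightarrow> real \<times> real \<times> real" where
  "wrapped_fold A B = (\<lambda>(z, w). solid_fold (z powi A, w * z powi B))"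

text \<open>The deck transformations of the self-covering are the rotations by the roots of unity.\<close>

lemma same_wrapping_iff:
  fixes z z' w w' :: complex
  assumes "z \<noteq> 0" "z' \<noteq> 0"
  shows "z' powi A = z powi A \<and> w' * z' powi B = w * z powi B \<longleftrightarrow>
    (\<exists>\<mu>. \<mu> powi A = 1 \<and> z' = \<mu> * z \<and> w' = \<mu> powi (- B) * w)"
proof
  assume "z' powi A = z powi A \<and> w' * z' powi B = w * z powi B"
  then show "\<exists>\<mu>. \<mu> powi A = 1 \<and> z' = \<mu> * z \<and> w' = \<mu> powi (- B) * w"
    using assms
    by (intro exI[of _ "z' / z"]) (simp add: power_int_divide_distrib power_int_minus field_simps)
next
  assume "\<exists>\<mu>. \<mu> powi A = 1 \<and> z' = \<mu> * z \<and> w' = \<mu> powi (- B) * w"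
  then obtain \<mu> where "\<mu> powi A = 1" "z' = \<mu> * z" "w' = \<mu> powi (- B) * w" by blast
  moreover from this assms have "\<mu> \<noteq> 0" by auto
  ultimately show "z' powi A = z powi A \<and> w' * z' powi B = w * z powi B"
    by (simp add: power_int_mult_distrib power_int_minus)
qed

lemma wrapped_fold_eq_iff:
  assumes "cmod z = 1" "cmod z' = 1"
  shows "wrapped_fold A B (z, w) = wrapped_fold A B (z', w') \<longleftrightarrow>
    (\<exists>\<mu>. \<mu> powi A = 1 \<and> (z' = \<mu> * z \<and> w' = \<mu> powi (- B) * w \<or> z' = \<mu> * cnj z \<and> w' = \<mu> powi (- B) * cnj w))"
proof -
  have nz: "z \<noteq> 0" "z' \<noteq> 0" "cnj z \<noteq> 0" using assms by auto
  have "wrapped_fold A B (z, w) = wrapped_fold A B (z', w') \<longleftrightarrow>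
      z' powi A = z powi A \<and> w' * z' powi B = w * z powi B \<or>
      z' powi A = cnj z powi A \<and> w' * z' powi B = cnj w * cnj z powi B"
    using solid_fold_eq_iff[of "z powi A" "z' powi A"] assms
    by (simp add: wrapped_fold_def norm_power_int)
  also have "\<dots> \<longleftrightarrow> (\<exists>\<mu>. \<mu> powi A = 1 \<and> z' = \<mu> * z \<and> w' = \<mu> powi (- B) * w) \<or>
      (\<exists>\<mu>. \<mu> powi A = 1 \<and> z' = \<mu> * cnj z \<and> w' = \<mu> powi (- B) * cnj w)"
    by (simp only: same_wrapping_iff[OF nz(1,2)] same_wrapping_iff[OF nz(3,2)])
  finally show ?thesis by blast
qed

lemma wrapped_fold_vertical_arcs:
  assumes "cmod z = 1" "cmod w \<le> 1"
  shows "wrapped_fold A B (z, w) \<in> vertical_arcs \<longleftrightarrow>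
    (\<exists>\<mu>. \<mu> powi A = 1 \<and> z = \<mu> * cnj z \<and> w = \<mu> powi (- B) * cnj w)"
proof -
  have nz: "z \<noteq> 0" "cnj z \<noteq> 0" using assms by auto
  show ?thesis
    using solid_fold_vertical_arcs[of "z powi A" "w * z powi B"] assms same_wrapping_iff[OF nz(2,1), of A w B "cnj w"]
    by (simp add: wrapped_fold_def norm_power_int norm_mult)
qed

lemma wrapped_fold_frontier:
  assumes "cmod z = 1" "cmod w \<le> 1"
  shows "wrapped_fold A B (z, w) \<in> frontier tangle_ball \<longleftrightarrow> cmod w = 1"
  using solid_fold_frontier[of "z powi A" "w * z powi B"] assms
  by (simp add: wrapped_fold_def norm_power_int norm_mult)

lemma compact_solid_torus: "compact solid_torus"
proof -
  have "solid_torus = sphere 0 1 \<times> cball 0 1" by (auto simp: solid_torus_def)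
  then show ?thesis by (metis compact_Times compact_sphere compact_cball)
qed

lemma quotient_map_wrapped_fold:
  assumes "A \<noteq> 0"
  shows "quotient_map (top_of_set solid_torus) (top_of_set tangle_ball) (wrapped_fold A B)"
proof -
  let ?k = "\<lambda>(z, w). (z powi A, w * z powi B) :: complex \<times> complex"
  have im: "?k ` solid_torus = solid_torus"
  proof
    show "?k ` solid_torus \<subseteq> solid_torus"
      by (auto simp: solid_torus_def norm_power_int norm_mult)
    show "solid_torus \<subseteq> ?k ` solid_torus"
    proof clarify
      fix a d assume "(a, d) \<in> solid_torus"
      then have ad: "cmod a = 1" "cmod d \<le> 1" by (auto simp: solid_torus_def)
      define z where "z = cis (Arg a / A)"
      have "z powi A = cis (Arg a)" using assms by (simp add: z_def cis_power_int)
      then have "z powi A = a" using ad(1) by (metis cis_Arg norm_zero sgn_div_norm scaleR_one inverse_1 zero_neq_one)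
      moreover have "cmod z = 1" by (simp add: z_def)
      moreover from this have "cmod (z powi B) = 1" by (simp add: norm_power_int)
      ultimately show "(a, d) \<in> ?k ` solid_torus"
        using ad by (intro image_eqI[of _ _ "(z, d / z powi B)"]) (auto simp: solid_torus_def norm_divide)
    qed
  qed
  have eq: "wrapped_fold A B = solid_fold \<circ> ?k" by (auto simp: wrapped_fold_def)
  have nz: "fst x \<noteq> 0" if "x \<in> solid_torus" for x using that by (auto simp: solid_torus_def)
  have "continuous_on solid_torus ?k"
    unfolding case_prod_unfold using nz by (intro continuous_intros) auto
  then have "continuous_on solid_torus (wrapped_fold A B)"
    unfolding eq by (rule continuous_on_compose) (rule continuous_on_solid_fold)
  moreover have "wrapped_fold A B ` solid_torus = tangle_ball"
    unfolding eq image_comp[symmetric] im by (rule solid_fold_image)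
  ultimately show ?thesis
    using compact_solid_torus
    by (intro T1_Spaces.continuous_imp_quotient_map)
      (auto simp: compact_space_subtopology Hausdorff_space_subtopology continuous_map_in_subtopology)
qed

definition dihedral_rotation :: "int \<Rightarrow> complex \<Rightarrow> complex \<times> complex \<Rightarrow> complex \<times> complex" where
  "dihedral_rotation B \<mu> = (\<lambda>(z, w). (\<mu> * z, \<mu> powi (- B) * w))"

definition dihedral_reflection :: "int \<Rightarrow> complex \<Rightarrow> complex \<times> complex \<Rightarrow> complex \<times> complex" where
  "dihedral_reflection B \<mu> = (\<lambda>(z, w). (\<mu> * cnj z, \<mu> powi (- B) * cnj w))"

definition dihedral_group :: "int \<Rightarrow> int \<Rightarrow> (complex \<times> complex \<Rightarrow> complex \<times> complex) set" where
  "dihedral_group A B =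
     dihedral_rotation B ` {\<mu>. \<mu> powi A = 1} \<union> dihedral_reflection B ` {\<mu>. \<mu> powi A = 1}"

lemma dihedral_orbit_iff:
  "(\<exists>g\<in>dihedral_group A B. (z', w') = g (z, w)) \<longleftrightarrow>
    (\<exists>\<mu>. \<mu> powi A = 1 \<and> (z' = \<mu> * z \<and> w' = \<mu> powi (- B) * w \<or> z' = \<mu> * cnj z \<and> w' = \<mu> powi (- B) * cnj w))"
  by (simp add: dihedral_group_def dihedral_rotation_def dihedral_reflection_def bex_Un) blast

text \<open>Together with \<open>\<bar>C\<bar> = \<bar>A\<bar>\<close> the condition \<open>A dvd B * D - 1\<close> says that the same finite group of rotations is obtained from
  either solid torus (\<open>swap_roots\<close>), and \<open>compat\<close> says that the maps from the two solid tori agree on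
  their common boundary after the gluing by \<open>h\<close>.\<close>

locale dihedral_cover =
  fixes A B C D :: int and h :: "real \<times> real \<times> real \<Rightarrow> real \<times> real \<times> real"
  assumes A: "A \<noteq> 0" and AC: "\<bar>C\<bar> = \<bar>A\<bar>" and BD: "A dvd B * D - 1"
    and h: "homeomorphic_map (top_of_set (frontier tangle_ball)) (top_of_set (frontier tangle_ball)) h"
    and compat: "\<And>z w. \<lbrakk>cmod z = 1; cmod w = 1\<rbrakk> \<Longrightarrow> h (wrapped_fold A B (z, w)) = wrapped_fold C D (w, z)"
begin

lemma C: "C \<noteq> 0" using A AC by auto

lemma powi_C_iff: "\<mu> powi C = 1 \<longleftrightarrow> \<mu> powi A = (1 :: complex)"
proof -
  have "C = A \<or> C = - A" using AC by linarith
  then show ?thesis by (auto simp: power_int_minus)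
qed

text \<open>A rotation is parametrized either by its effect \<open>\<mu>\<close> on the first coordinate or by its effect
  \<open>\<nu> = \<mu>\<^sup>-\<^sup>B\<close> on the second; the exponent \<open>- D\<close> leads back.\<close>

lemma swap_roots:
  "(\<exists>\<mu>::complex. \<mu> powi A = 1 \<and> P \<mu> (\<mu> powi (- B))) \<longleftrightarrow> (\<exists>\<nu>::complex. \<nu> powi C = 1 \<and> P (\<nu> powi (- D)) \<nu>)"
proof -
  have inv: "(\<mu> powi (- B)) powi A = 1 \<and> (\<mu> powi (- B)) powi (- D) = \<mu>"
    if "\<mu> powi A = 1" "A dvd B * D - 1" for \<mu> :: complex and B D
  proof -
    have "(\<mu> powi (- B)) powi A = (\<mu> powi A) powi (- B)" by (simp only: power_int_mult[symmetric] mult.commute)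
    moreover have "(\<mu> powi (- B)) powi (- D) = \<mu> powi (B * D)" by (simp add: power_int_mult[symmetric])
    ultimately show ?thesis using that root_of_unity_inverse_exponent[OF A that(2,1)] by simp
  qed
  have DB: "A dvd D * B - 1" using BD by (simp add: mult.commute)
  show ?thesis unfolding powi_C_iff using inv[OF _ BD] inv[OF _ DB] by metis
qed

definition gluing_equiv where "gluing_equiv = glue_equiv two_balls (gluing_rel h)"

lemma h_frontier: "x \<in> frontier tangle_ball \<Longrightarrow> h x \<in> frontier tangle_ball"
  using homeomorphic_imp_surjective_map[OF h] by auto

lemma topspace_two_balls: "topspace two_balls = UNIV \<times> tangle_ball"
  by (auto simp: two_balls_def)

lemma gluing_equiv_iff:
  "((i, x), (j, y)) \<in> gluing_equiv \<longleftrightarrow> x \<in> tangle_ball \<and> y \<in> tangle_ball \<and>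
     (i = j \<and> x = y \<or> \<not> i \<and> j \<and> x \<in> frontier tangle_ball \<and> y = h x \<or>
      i \<and> \<not> j \<and> y \<in> frontier tangle_ball \<and> x = h y)"
proof -
  have inj: "x = y" if "x \<in> frontier tangle_ball" "y \<in> frontier tangle_ball" "h x = h y" for x y
    using homeomorphic_imp_injective_map[OF h] that by (auto simp: inj_on_def)
  have "(gluing_rel h \<union> (gluing_rel h)\<inverse>)\<^sup>* = Id \<union> gluing_rel h \<union> (gluing_rel h)\<inverse>"
  proof (rule rtrancl_matching)
    show "single_valued ((gluing_rel h)\<inverse>)"
      unfolding single_valued_def gluing_rel_def using inj by blast
    show "single_valued (gluing_rel h)"
      unfolding single_valued_def gluing_rel_def by blast
  qed (auto simp: gluing_rel_def)
  moreover have "((i, x), (j, y)) \<in> gluing_rel h \<longleftrightarrow> \<not> i \<and> j \<and> x \<in> frontier tangle_ball \<and> y = h x" for i j x y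
    unfolding gluing_rel_def mem_Collect_eq prod.inject by blast
  ultimately show ?thesis
    by (auto simp: gluing_equiv_def glue_equiv_def topspace_two_balls)
qed

lemma equiv_gluing_equiv: "equiv (topspace two_balls) gluing_equiv"
  unfolding gluing_equiv_def by (rule equiv_glue_equiv)

lemma class_eq_iff:
  "x \<in> tangle_ball \<Longrightarrow> y \<in> tangle_ball \<Longrightarrow> gluing_equiv `` {(i, x)} = gluing_equiv `` {(j, y)} \<longleftrightarrow> ((i, x), (j, y)) \<in> gluing_equiv"
  by (rule eq_equiv_class_iff[OF equiv_gluing_equiv]) (auto simp: topspace_two_balls)

lemma quotient_map_class: "quotient_map two_balls (glued_sphere h) (\<lambda>x. gluing_equiv `` {x})"
  unfolding glued_sphere_def glue_space_def using quotient_map_quotient_topology[OF equiv_gluing_equiv] by (simp add: gluing_equiv_def)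

text \<open>On the torus \<open>cmod z = cmod w = 1\<close> the choice of the first ball is arbitrary: the other choice gives
  an equivalent point by \<open>compat\<close>.\<close>

definition ball_point where
  "ball_point = (\<lambda>(z, w). if cmod z = 1 then (False, wrapped_fold A B (z, w)) else (True, wrapped_fold C D (w, z)))"

definition orbit_map where "orbit_map = (\<lambda>x. gluing_equiv `` {ball_point x})"

lemma sphere_cases:
  assumes "(z, w) \<in> bidisc_sphere"
  obtains "cmod z = 1" "cmod w \<le> 1" | "cmod w = 1" "cmod z < 1"
proof (cases "cmod z = 1")
  case True
  then show ?thesis using assms that(1) by (simp add: bidisc_sphere_def max_def split: if_splits)
next
  case False
  then show ?thesis using assms that(2) by (auto simp: bidisc_sphere_def max_def split: if_splits)
qed

lemma wrapped_fold_ball: "A' \<noteq> 0 \<Longrightarrow> cmod z = 1 \<Longrightarrow> cmod w \<le> 1 \<Longrightarrow> wrapped_fold A' B' (z, w) \<in> tangle_ball"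
  using quotient_imp_surjective_map[OF quotient_map_wrapped_fold, of A' B'] by (auto simp: solid_torus_def)

text \<open>Within one solid torus this is the description of the fibers of \<open>wrapped_fold\<close>. Points that lie
  in different balls and not on the common boundary are never identified, and rotations and
  conjugations preserve the absolute values of the coordinates.\<close>

lemma orbit_map_eq_iff:
  assumes x: "x \<in> bidisc_sphere" and y: "y \<in> bidisc_sphere"
  shows "orbit_map x = orbit_map y \<longleftrightarrow> (\<exists>g\<in>dihedral_group A B. y = g x)"
proof -
  have nm: "cmod z' = cmod z" if "\<exists>g\<in>dihedral_group A B. (z', w') = g (z, w)" for z w z' w'
    using that norm_root_of_unity_int[OF A] unfolding dihedral_orbit_iff by (auto simp: norm_mult)
  obtain z w z' w' where xy: "x = (z, w)" "y = (z', w')" by (cases x, cases y)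
  show ?thesis
    using x[unfolded xy]
  proof (cases rule: sphere_cases)
    case 1
    note z = this
    show ?thesis
      using y[unfolded xy]
    proof (cases rule: sphere_cases)
      case 1
      then show ?thesis
        using z unfolding xy dihedral_orbit_iff
        by (simp add: orbit_map_def ball_point_def class_eq_iff gluing_equiv_iff wrapped_fold_ball A wrapped_fold_eq_iff)
    next
      case 2
      have "wrapped_fold C D (w', z') \<notin> frontier tangle_ball"
        using 2 by (simp add: wrapped_fold_frontier)
      then have "orbit_map x \<noteq> orbit_map y"
        using z 2 h_frontier[of "wrapped_fold A B (z, w)"]
        by (auto simp: xy orbit_map_def ball_point_def class_eq_iff gluing_equiv_iff wrapped_fold_ball A C)
      then show ?thesis using nm[of z' w' z w] z 2 unfolding xy by auto
    qed
  next
    case 2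
    note w = this
    show ?thesis
      using y[unfolded xy]
    proof (cases rule: sphere_cases)
      case 1
      have "wrapped_fold C D (w, z) \<notin> frontier tangle_ball"
        using w by (simp add: wrapped_fold_frontier)
      then have "orbit_map x \<noteq> orbit_map y"
        using w 1 h_frontier[of "wrapped_fold A B (z', w')"]
        by (auto simp: xy orbit_map_def ball_point_def class_eq_iff gluing_equiv_iff wrapped_fold_ball A C)
      then show ?thesis using nm[of z' w' z w] w 1 unfolding xy by auto
    next
      case 2
      have "orbit_map x = orbit_map y \<longleftrightarrow> wrapped_fold C D (w, z) = wrapped_fold C D (w', z')"
        using w 2 by (simp add: xy orbit_map_def ball_point_def class_eq_iff gluing_equiv_iff wrapped_fold_ball C)
      also have "\<dots> \<longleftrightarrow> (\<exists>\<nu>. \<nu> powi C = 1 \<and> (z' = \<nu> powi (- D) * z \<and> w' = \<nu> * w \<or> z' = \<nu> powi (- D) * cnj z \<and> w' = \<nu> * cnj w))"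
        unfolding wrapped_fold_eq_iff[OF w(1) 2(1)] by (simp only: conj_commute)
      also have "\<dots> \<longleftrightarrow> (\<exists>g\<in>dihedral_group A B. y = g x)"
        unfolding xy dihedral_orbit_iff
        by (rule swap_roots[of "\<lambda>\<mu> \<nu>. z' = \<mu> * z \<and> w' = \<nu> * w \<or> z' = \<mu> * cnj z \<and> w' = \<nu> * cnj w", symmetric])
      finally show ?thesis .
    qed
  qed
qed

text \<open>The vertical arcs of each ball are the images of the points fixed by some conjugation, and by
  \<open>swap_roots\<close> the descriptions from the two solid tori agree. In particular they agree on the common
  torus, so the link has no further points there.\<close>

lemma orbit_map_link_iff:
  assumes "x \<in> bidisc_sphere"
  shows "orbit_map x \<in> two_bridge_link h \<longleftrightarrow> x \<in> circle_link A B"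
proof -
  obtain z w where x: "x = (z, w)" by (cases x)
  have va: "vertical_arcs \<subseteq> tangle_ball"
  proof clarify
    fix u v t assume "(u, v, t) \<in> vertical_arcs"
    then have "\<bar>v\<bar> \<le> 1" "t = 0" "\<bar>u\<bar> = (1 + v\<^sup>2) / 2" by (auto simp: vertical_arcs_def)
    moreover from this have "v\<^sup>2 \<le> 1" by (simp add: abs_square_le_1)
    moreover from calculation have "\<bar>u\<bar> \<le> 1" by simp
    moreover from this have "u\<^sup>2 \<le> 1" by (simp add: abs_square_le_1)
    ultimately show "(u, v, t) \<in> tangle_ball" by (auto simp: tangle_ball_def)
  qed
  have link: "gluing_equiv `` {(i, p)} \<in> two_bridge_link h \<longleftrightarrow> (\<exists>j. \<exists>v\<in>vertical_arcs. ((i, p), (j, v)) \<in> gluing_equiv)"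
    if p: "p \<in> tangle_ball" for i p
  proof -
    have "gluing_equiv `` {(i, p)} \<in> two_bridge_link h \<longleftrightarrow> (\<exists>j. \<exists>v\<in>vertical_arcs. gluing_equiv `` {(i, p)} = gluing_equiv `` {(j, v)})"
      by (auto simp: two_bridge_link_def gluing_equiv_def image_iff)
    also have "\<dots> \<longleftrightarrow> (\<exists>j. \<exists>v\<in>vertical_arcs. ((i, p), (j, v)) \<in> gluing_equiv)"
      using class_eq_iff[OF p] va by blast
    finally show ?thesis .
  qed
  have swap: "(\<exists>\<mu>. \<mu> powi A = 1 \<and> z = \<mu> * cnj z \<and> w = \<mu> powi (- B) * cnj w) \<longleftrightarrow>
      (\<exists>\<nu>. \<nu> powi C = 1 \<and> w = \<nu> * cnj w \<and> z = \<nu> powi (- D) * cnj z)"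
    using swap_roots[of "\<lambda>\<mu> \<nu>. z = \<mu> * cnj z \<and> w = \<nu> * cnj w"] by (simp only: conj_commute)
  have K: "x \<in> circle_link A B \<longleftrightarrow> (\<exists>\<mu>. \<mu> powi A = 1 \<and> z = \<mu> * cnj z \<and> w = \<mu> powi (- B) * cnj w)"
    using assms by (auto simp: circle_link_def x)
  show ?thesis
    using assms[unfolded x]
  proof (cases rule: sphere_cases)
    case 1
    let ?p = "wrapped_fold A B (z, w)"
    have p: "?p \<in> tangle_ball" using 1 by (simp add: wrapped_fold_ball A)
    have "h ?p \<in> vertical_arcs \<longleftrightarrow> ?p \<in> vertical_arcs" if "?p \<in> frontier tangle_ball"
    proof -
      have "cmod w = 1" using that 1 by (simp add: wrapped_fold_frontier)
      then show ?thesis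
        using 1 by (simp add: compat wrapped_fold_vertical_arcs swap)
    qed
    then have "orbit_map x \<in> two_bridge_link h \<longleftrightarrow> ?p \<in> vertical_arcs"
      using 1 link[OF p, of False] p va by (auto simp: x orbit_map_def ball_point_def gluing_equiv_iff)
    then show ?thesis using 1 K by (simp add: wrapped_fold_vertical_arcs)
  next
    case 2
    let ?p = "wrapped_fold C D (w, z)"
    have p: "?p \<in> tangle_ball" using 2 by (simp add: wrapped_fold_ball C)
    have "?p \<notin> frontier tangle_ball" using 2 by (simp add: wrapped_fold_frontier)
    then have "orbit_map x \<in> two_bridge_link h \<longleftrightarrow> ?p \<in> vertical_arcs"
      using 2 link[OF p, of True] p va h_frontier by (auto simp: x orbit_map_def ball_point_def gluing_equiv_iff)
    then show ?thesis using 2 K swap by (simp add: wrapped_fold_vertical_arcs)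
  qed
qed

text \<open>The disjoint union of the two solid tori maps onto the boundary of the bidisc and, ball by ball,
  onto the glued sphere. Both are quotient maps, since they arise from maps of compact spaces onto
  Hausdorff spaces and from the gluing itself.\<close>

lemma quotient_map_orbit_map: "quotient_map (top_of_set bidisc_sphere) (glued_sphere h) orbit_map"
proof -
  let ?X = "sum_topology (\<lambda>_::bool. top_of_set solid_torus) UNIV"
  define j :: "bool \<times> complex \<times> complex \<Rightarrow> complex \<times> complex" where
    "j = (\<lambda>(i, x). if i then prod.swap x else x)"
  define \<sigma> where "\<sigma> = (\<lambda>(i, x). (i, (if i then wrapped_fold C D else wrapped_fold A B) x))"
  have topX: "topspace ?X = UNIV \<times> solid_torus" by auto
  have "quotient_map ?X two_balls \<sigma>"
    unfolding \<sigma>_def two_balls_def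
    by (rule quotient_map_sum_topology) (simp add: quotient_map_wrapped_fold A C)
  then have \<sigma>: "quotient_map ?X (glued_sphere h) ((\<lambda>x. gluing_equiv `` {x}) \<circ> \<sigma>)"
    using quotient_map_class by (rule quotient_map_compose)
  have jc: "continuous_map ?X (top_of_set bidisc_sphere) j"
  proof (rule continuous_map_from_sum_topology)
    fix i :: bool
    have "prod.swap x \<in> bidisc_sphere" "x \<in> bidisc_sphere" if "x \<in> solid_torus" for x
      using that by (auto simp: solid_torus_def bidisc_sphere_def)
    then show "continuous_map (top_of_set solid_torus) (top_of_set bidisc_sphere) (\<lambda>x. j (i, x))"
      by (cases i) (auto simp: j_def continuous_map_in_subtopology prod.swap_def intro!: continuous_intros)
  qed
  have js: "j ` topspace ?X = topspace (top_of_set bidisc_sphere)"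
  proof
    show "j ` topspace ?X \<subseteq> topspace (top_of_set bidisc_sphere)"
      using jc by (rule continuous_map_image_subset_topspace)
    show "topspace (top_of_set bidisc_sphere) \<subseteq> j ` topspace ?X"
    proof clarsimp
      fix z w assume "(z, w) \<in> bidisc_sphere"
      then show "(z, w) \<in> j ` (UNIV \<times> solid_torus)"
      proof (cases rule: sphere_cases)
        case 1
        then show ?thesis by (intro image_eqI[of _ _ "(False, z, w)"]) (auto simp: j_def solid_torus_def)
      next
        case 2
        then show ?thesis by (intro image_eqI[of _ _ "(True, w, z)"]) (auto simp: j_def solid_torus_def)
      qed
    qed
  qed
  have j: "quotient_map ?X (top_of_set bidisc_sphere) j"
    using jc js compact_solid_torus
    by (intro T1_Spaces.continuous_imp_quotient_map compact_space_sum_topology)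
      (auto simp: compact_space_subtopology Hausdorff_space_subtopology)
  have eq: "(orbit_map \<circ> j) x = ((\<lambda>x. gluing_equiv `` {x}) \<circ> \<sigma>) x" if x: "x \<in> topspace ?X" for x
  proof -
    obtain i a d where iad: "x = (i, a, d)" by (cases x)
    then have ad: "cmod a = 1" "cmod d \<le> 1" using x by (auto simp: solid_torus_def)
    show ?thesis
    proof (cases "i \<and> cmod d = 1")
      case True
      have "((False, wrapped_fold A B (d, a)), (True, wrapped_fold C D (a, d))) \<in> gluing_equiv"
        using True ad by (simp add: gluing_equiv_iff wrapped_fold_ball A C wrapped_fold_frontier compat)
      then show ?thesis
        using True ad class_eq_iff by (simp add: iad orbit_map_def ball_point_def j_def \<sigma>_def wrapped_fold_ball A C)
    next
      case False
      then show ?thesis using ad by (auto simp: iad orbit_map_def ball_point_def j_def \<sigma>_def)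
    qed
  qed
  have cj: "quotient_map ?X (glued_sphere h) (orbit_map \<circ> j)"
    by (rule quotient_map_eq[OF \<sigma> eq[symmetric]])
  have "continuous_map (top_of_set bidisc_sphere) (glued_sphere h) orbit_map"
    by (rule continuous_compose_quotient_map[OF j quotient_imp_continuous_map[OF cj]])
  then show ?thesis by (rule quotient_map_from_composition[OF jc _ cj])
qed

lemma closed_circle_link: "closed (circle_link A B)"
proof -
  have "circle_link A B = (\<Union>\<mu>\<in>{\<mu>. \<mu> powi A = 1}. {x. max (cmod (fst x)) (cmod (snd x)) = 1 \<and>
      fst x = \<mu> * cnj (fst x) \<and> snd x = \<mu> powi (- B) * cnj (snd x)})"
    by (auto simp: circle_link_def bidisc_sphere_def)
  moreover have "closed {x :: complex \<times> complex. max (cmod (fst x)) (cmod (snd x)) = 1 \<and>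
      fst x = \<mu> * cnj (fst x) \<and> snd x = \<mu> powi (- B) * cnj (snd x)}" for \<mu>
    by (intro closed_Collect_conj closed_Collect_eq continuous_intros)
  ultimately show ?thesis
    using finite_roots_of_unity_int[OF A] by (simp add: closed_UN)
qed

lemma dihedral_group_homeomorphic:
  assumes g: "g \<in> dihedral_group A B"
  shows "homeomorphic_map (top_of_set (bidisc_sphere - circle_link A B)) (top_of_set (bidisc_sphere - circle_link A B)) g"
    (is "homeomorphic_map ?N ?N g")
proof -
  have cont: "continuous_on X k" if "k \<in> dihedral_group A B" for k X
    using that unfolding dihedral_group_def dihedral_rotation_def dihedral_reflection_def case_prod_unfold
    by (auto intro!: continuous_intros)
  have sphere: "k x \<in> bidisc_sphere" if "k \<in> dihedral_group A B" "x \<in> bidisc_sphere" for k x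
    using that norm_root_of_unity_int[OF A]
    by (auto simp: dihedral_group_def dihedral_rotation_def dihedral_reflection_def bidisc_sphere_def norm_mult norm_power_int)
  have pres: "k x \<in> bidisc_sphere - circle_link A B" if k: "k \<in> dihedral_group A B" and x: "x \<in> bidisc_sphere - circle_link A B" for k x
  proof -
    have "orbit_map x = orbit_map (k x)" using x k orbit_map_eq_iff[of x "k x"] sphere[OF k, of x] by blast
    then show ?thesis using x sphere[OF k, of x] orbit_map_link_iff by (metis DiffD1 DiffD2 DiffI)
  qed
  have "\<exists>k\<in>dihedral_group A B. \<forall>x. k (g x) = x \<and> g (k x) = x"
    using g unfolding dihedral_group_def
  proof (elim UnE imageE)
    fix \<mu> assume \<mu>: "g = dihedral_rotation B \<mu>" "\<mu> \<in> {\<mu>. \<mu> powi A = 1}"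
    then have "\<mu> \<noteq> 0" using norm_root_of_unity_int[OF A, of \<mu>] by auto
    then show "\<exists>k\<in>dihedral_rotation B ` {\<mu>. \<mu> powi A = 1} \<union> dihedral_reflection B ` {\<mu>. \<mu> powi A = 1}. \<forall>x. k (g x) = x \<and> g (k x) = x"
    proof (intro bexI[of _ "dihedral_rotation B (inverse \<mu>)"] allI)
      show "dihedral_rotation B (inverse \<mu>) \<in> dihedral_rotation B ` {\<mu>. \<mu> powi A = 1} \<union> dihedral_reflection B ` {\<mu>. \<mu> powi A = 1}"
        using \<mu>(2) by (intro UnI1 imageI) (simp add: power_int_inverse)
    qed (use \<mu>(1) \<open>\<mu> \<noteq> 0\<close> in \<open>auto simp: dihedral_rotation_def power_int_inverse power_int_minus\<close>)
  next
    fix \<mu> assume \<mu>: "g = dihedral_reflection B \<mu>" "\<mu> \<in> {\<mu>. \<mu> powi A = 1}"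
    then have n: "cmod \<mu> = 1" using norm_root_of_unity_int[OF A, of \<mu>] by auto
    then have "\<mu> * cnj \<mu> = 1" by (simp add: complex_norm_square[symmetric])
    moreover have "\<mu> powi (- B) * cnj (\<mu> powi (- B)) = 1"
      using n by (simp add: complex_norm_square[symmetric] norm_power_int del: complex_cnj_power_int)
    ultimately show "\<exists>k\<in>dihedral_rotation B ` {\<mu>. \<mu> powi A = 1} \<union> dihedral_reflection B ` {\<mu>. \<mu> powi A = 1}. \<forall>x. k (g x) = x \<and> g (k x) = x"
      using \<mu> by (intro bexI[of _ g]) (auto simp: dihedral_reflection_def mult.assoc[symmetric])
  qed
  then obtain k where k: "k \<in> dihedral_group A B" "\<And>x. k (g x) = x" "\<And>x. g (k x) = x" by blast
  have "homeomorphic_maps ?N ?N g k"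
    unfolding homeomorphic_maps_def
    using k(2,3) pres[OF g] pres[OF k(1)] cont[OF g] cont[OF k(1)]
    by (auto simp: continuous_map_in_subtopology)
  then show ?thesis by (auto simp: homeomorphic_map_maps)
qed

text \<open>If a rotation and a reflection agree at a point, their quotient is a reflection that fixes the
  point, which puts it on the link. Two rotations that agree there have the same
  parameter because one of the coordinates is nonzero, and likewise two reflections.\<close>

lemma dihedral_group_free:
  assumes x: "x \<in> bidisc_sphere - circle_link A B" and g: "g \<in> dihedral_group A B" and k: "k \<in> dihedral_group A B"
    and eq: "g x = k x"
  shows "g = k"
proof -
  obtain z w where zw: "x = (z, w)" by (cases x)
  have nz: "z \<noteq> 0 \<or> w \<noteq> 0" using x by (auto simp: zw bidisc_sphere_def)
  have uniq: "\<mu> = \<nu>"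
    if "\<mu> powi A = 1" "\<nu> powi A = 1" "\<mu> * z' = \<nu> * z'" "\<mu> powi (- B) * w' = \<nu> powi (- B) * w'" "z' \<noteq> 0 \<or> w' \<noteq> 0"
    for \<mu> \<nu> z' w' :: complex
  proof (cases "z' = 0")
    case True
    then have "\<mu> powi B = \<nu> powi B" using that by (simp add: power_int_minus)
    then have "\<mu> powi (B * D) = \<nu> powi (B * D)" by (simp add: power_int_mult)
    then show ?thesis using root_of_unity_inverse_exponent[OF A BD] that(1,2) by simp
  qed (use that in simp)
  have mixed: False
    if "\<mu> powi A = 1" "\<nu> powi A = 1" "\<mu> * z = \<nu> * cnj z" "\<mu> powi (- B) * w = \<nu> powi (- B) * cnj w"
    for \<mu> \<nu> :: complex
  proof -
    have "\<mu> \<noteq> 0" "\<nu> \<noteq> 0" using that norm_root_of_unity_int[OF A] by force+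
    then have "(\<nu> / \<mu>) powi A = 1" "z = (\<nu> / \<mu>) * cnj z" "w = (\<nu> / \<mu>) powi (- B) * cnj w"
      using that by (simp_all add: power_int_divide_distrib power_int_minus field_simps)
    then have "x \<in> circle_link A B" using x unfolding circle_link_def zw by blast
    then show False using x by blast
  qed
  consider (rr) \<mu> \<nu> where "g = dihedral_rotation B \<mu>" "k = dihedral_rotation B \<nu>" "\<mu> powi A = 1" "\<nu> powi A = 1"
    | (ss) \<mu> \<nu> where "g = dihedral_reflection B \<mu>" "k = dihedral_reflection B \<nu>" "\<mu> powi A = 1" "\<nu> powi A = 1"
    | (rs) \<mu> \<nu> where "g = dihedral_rotation B \<mu>" "k = dihedral_reflection B \<nu>" "\<mu> powi A = 1" "\<nu> powi A = 1"
    | (sr) \<mu> \<nu> where "g = dihedral_reflection B \<mu>" "k = dihedral_rotation B \<nu>" "\<mu> powi A = 1" "\<nu> powi A = 1"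
    using g k unfolding dihedral_group_def by blast
  then show ?thesis
  proof cases
    case rr
    then show ?thesis using uniq[of \<mu> \<nu> z w] eq nz by (simp add: zw dihedral_rotation_def)
  next
    case ss
    then show ?thesis using uniq[of \<mu> \<nu> "cnj z" "cnj w"] eq nz by (simp add: zw dihedral_reflection_def)
  next
    case rs
    then show ?thesis using mixed[of \<mu> \<nu>] eq by (simp add: zw dihedral_rotation_def dihedral_reflection_def)
  next
    case sr
    then show ?thesis using mixed[of \<nu> \<mu>] eq by (simp add: zw dihedral_rotation_def dihedral_reflection_def)
  qed
qed

lemma finite_sheeted_covering_orbit_map:
  "finite_sheeted_covering_map (top_of_set (bidisc_sphere - circle_link A B)) (two_bridge_complement h) orbit_map"
proof (rule finite_free_action_covering)
  let ?V = "topspace (glued_sphere h) - two_bridge_link h"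
  have pre: "{x \<in> topspace (top_of_set bidisc_sphere). orbit_map x \<in> ?V} = bidisc_sphere - circle_link A B"
    using orbit_map_link_iff quotient_imp_surjective_map[OF quotient_map_orbit_map] by auto
  have "openin (top_of_set bidisc_sphere) (bidisc_sphere - circle_link A B)"
    using openin_open_Int[of "- circle_link A B" bidisc_sphere] closed_circle_link
    by (simp add: open_Compl Diff_eq)
  then have "openin (glued_sphere h) ?V"
    using quotient_map_orbit_map[unfolded quotient_map_def, THEN conjunct2, rule_format, of ?V] unfolding pre by blast
  then have "quotient_map (subtopology (top_of_set bidisc_sphere) (bidisc_sphere - circle_link A B))
      (subtopology (glued_sphere h) ?V) orbit_map"
    by (intro quotient_map_restriction[OF quotient_map_orbit_map pre]) simp
  then show "quotient_map (top_of_set (bidisc_sphere - circle_link A B)) (two_bridge_complement h) orbit_map"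
    unfolding two_bridge_complement_def by (simp add: subtopology_subtopology Int_absorb1)
  show "finite (dihedral_group A B)"
    using finite_roots_of_unity_int[OF A] by (simp add: dihedral_group_def)
  have "id = dihedral_rotation B 1" by (auto simp: dihedral_rotation_def)
  then show "id \<in> dihedral_group A B" by (simp add: dihedral_group_def)
  show "g = k" if "g \<in> dihedral_group A B" "k \<in> dihedral_group A B"
    "x \<in> topspace (top_of_set (bidisc_sphere - circle_link A B))" "g x = k x" for g k x
    using dihedral_group_free[of x g k] that by simp
qed (simp_all add: Hausdorff_space_subtopology dihedral_group_homeomorphic orbit_map_eq_iff)

end

section \<open>Integer matrices of the gluing maps\<close>

lemma pillow_map_eq_lattice:
  "pillow_map z = pillow_map z' \<longleftrightarrow>
     (\<exists>m n :: int. z' = (fst z + 2 * of_int m, snd z + 2 * of_int n) \<or>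
                   z' = (2 * of_int m - fst z, 2 * of_int n - snd z))"
  unfolding pillow_map_eq_iff pillow_group_iff ..

text \<open>The linear map behind \<open>h\<close> preserves the lattice of integer points because \<open>h\<close> preserves the
  marked points, and its inverse preserves the even points because \<open>h\<close> is injective. So its matrix is
  integral with determinant \<open>1\<close> or \<open>-1\<close>. The entry \<open>b\<close> vanishes only if the slope \<open>\<infinity>\<close> is
  preserved, and this is excluded by \<open>q \<noteq> 0\<close>.\<close>

lemma two_bridge_gluing_matrix:
  assumes h: "two_bridge_gluing p q h" and q: "q \<noteq> 0"
  obtains a b c d :: int where "\<bar>a * d - b * c\<bar> = 1" "b \<noteq> 0"
    "\<And>x y. h (pillow_map (x, y)) = pillow_map (of_int a * x + of_int b * y, of_int c * x + of_int d * y)"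
proof -
  have hom: "homeomorphic_map (top_of_set (frontier tangle_ball)) (top_of_set (frontier tangle_ball)) h"
    and marked: "h ` marked_points = marked_points" and slope: "h ` slope_arcs 1 0 = slope_arcs p q"
    using h by (auto simp: two_bridge_gluing_def)
  obtain L where L: "linear L" "\<And>z. h (pillow_map z) = pillow_map (L z)"
    using h unfolding two_bridge_gluing_def by blast
  have int: "L (of_int i, of_int j) \<in> \<int> \<times> \<int>" for i j
  proof -
    have "pillow_map (of_int i, of_int j) \<in> marked_points" by (auto simp: marked_points_def)
    then have "pillow_map (L (of_int i, of_int j)) \<in> marked_points"
      using marked L(2) by (metis imageI)
    then obtain m n :: int where "pillow_map (of_int m, of_int n) = pillow_map (L (of_int i, of_int j))"
      unfolding marked_points_def by (auto elim!: Ints_cases)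
    then show ?thesis unfolding pillow_map_eq_lattice by auto
  qed
  obtain a c :: int where ac: "L (1, 0) = (of_int a, of_int c)"
    using int[of 1 0] by (auto elim!: Ints_cases)
  obtain b d :: int where bd: "L (0, 1) = (of_int b, of_int d)"
    using int[of 0 1] by (auto elim!: Ints_cases)
  have Lxy: "L (x, y) = (of_int a * x + of_int b * y, of_int c * x + of_int d * y)" for x y
  proof -
    have "L (x, y) = L (x *\<^sub>R (1, 0) + y *\<^sub>R (0, 1))" by simp
    also have "\<dots> = x *\<^sub>R L (1, 0) + y *\<^sub>R L (0, 1)"
      by (simp only: linear_add[OF L(1)] linear_scale[OF L(1)])
    finally show ?thesis by (simp add: ac bd mult.commute)
  qed
  have even: "\<exists>m n :: int. (x, y) = (2 * of_int m, 2 * of_int n)"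
    if "pillow_map (0, 0) = pillow_map (L (x, y))" for x y
  proof -
    have "L (0, 0) = (0, 0)" by (simp add: Lxy)
    then have "h (pillow_map (0, 0)) = h (pillow_map (x, y))" using that by (metis L(2))
    moreover have "pillow_map z \<in> frontier tangle_ball" for z using range_pillow_map(2) by blast
    ultimately have "pillow_map (0, 0) = pillow_map (x, y)"
      using homeomorphic_imp_injective_map[OF hom] by (simp add: inj_on_def)
    then show ?thesis unfolding pillow_map_eq_lattice by auto
  qed
  define e where "e = a * d - b * c"
  have det: "of_int e = of_int a * of_int d - of_int b * (of_int c :: real)" by (simp add: e_def)
  have "e \<noteq> 0"
  proof
    assume "e = 0"
    then have z: "of_int a * of_int d = of_int b * (of_int c :: real)" using det by simp
    have odd: "(1::real) \<noteq> 2 * of_int m" for m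
    proof
      assume "(1::real) = 2 * of_int m"
      then have "1 = 2 * m" by linarith
      then show False by presburger
    qed
    have no: "\<not> (L (x, y) = (0, 0) \<and> (x = 1 \<or> y = 1))" for x y
      using even[of x y] odd by force
    show False
    proof (cases "b = 0")
      case True
      show False
      proof (cases "d = 0")
        case True
        then show False using \<open>b = 0\<close> no[of 0 1] by (simp add: Lxy)
      next
        case False
        then have "a = 0" using \<open>e = 0\<close> True by (simp add: e_def)
        then show False using no[of 1 "- of_int c / of_int d"] True False by (simp add: Lxy)
      qed
    next
      case False
      have "L (1, - of_int a / of_int b) = (0, 0)"
        using False z by (simp add: Lxy field_simps)
      then show False using no by blast
    qed
  qed
  then have e0: "(of_int e :: real) \<noteq> 0" by simp
  have lat: "pillow_map (0, 0) = pillow_map (2 * of_int m, 2 * of_int n)" for m n :: int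
    unfolding pillow_map_eq_lattice by auto
  have dvd: "e dvd x" if "2 * of_int x / of_int e = (2 * of_int m :: real)" for x m
  proof -
    have "of_int x = (of_int (e * m) :: real)" using that e0 by (simp add: field_simps)
    then have "x = e * m" by linarith
    then show ?thesis by simp
  qed
  \<comment> \<open>The inverse matrix applied to the even points \<open>(2, 0)\<close> and \<open>(0, 2)\<close>.\<close>
  have "L (2 * of_int d / of_int e, 2 * of_int (- c) / of_int e) = (2 * of_int 1, 2 * of_int 0)"
    using e0 det by (simp add: Lxy field_simps)
  then have "e dvd d" "e dvd - c" using even lat dvd by (metis prod.inject)+
  moreover have "L (2 * of_int (- b) / of_int e, 2 * of_int a / of_int e) = (2 * of_int 0, 2 * of_int 1)"
    using e0 det by (simp add: Lxy field_simps)
  then have "e dvd - b" "e dvd a" using even lat dvd by (metis prod.inject)+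
  ultimately have "e * e dvd a * d" "e * e dvd b * c" by (simp_all add: mult_dvd_mono)
  then have "e * e dvd e" unfolding e_def by (rule dvd_diff)
  then have "e dvd 1" using \<open>e \<noteq> 0\<close> by (metis dvd_mult_cancel_left mult.right_neutral)
  then have e1: "\<bar>e\<bar> = 1" by simp
  have "b \<noteq> 0"
  proof
    assume b: "b = 0"
    \<comment> \<open>With this \<open>t\<close> the point \<open>(0, t)\<close> lies on an arc of slope \<open>\<infinity>\<close>, but its image \<open>(0, d t)\<close> could
      only lie on an arc of slope \<open>p/q\<close> if \<open>d\<close> were even.\<close>
    define t :: real where "t = 1 / (2 * of_int q)"
    have "(0, t) = (of_int 0 + t * of_int 0, of_int 0 + t * of_int 1)" by simp
    then have "pillow_map (0, t) \<in> slope_arcs 1 0" unfolding slope_arcs_def by blast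
    then have "h (pillow_map (0, t)) \<in> slope_arcs p q" using slope by blast
    then have "pillow_map (0, of_int d * t) \<in> slope_arcs p q" by (simp add: L(2) Lxy b)
    then obtain m n :: int and s where "pillow_map (0, of_int d * t) = pillow_map (of_int m + s * of_int q, of_int n + s * of_int p)"
      unfolding slope_arcs_def by blast
    then obtain k l :: int where k: "of_int m + s * of_int q = 2 * of_int k"
      and l: "of_int n + s * of_int p = of_int d * t + 2 * of_int l \<or> of_int n + s * of_int p = 2 * of_int l - of_int d * t"
      unfolding pillow_map_eq_lattice by auto
    have "of_int q * (of_int n + s * of_int p) = of_int q * of_int n + of_int p * (s * of_int q)" by (simp add: algebra_simps)
    also have "s * of_int q = 2 * of_int k - of_int m" using k by simp
    finally have 1: "of_int q * (of_int n + s * of_int p) = (of_int (q * n + p * (2 * k - m)) :: real)" by simp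
    have 2: "of_int q * (of_int d * t) = of_int d / 2" using q by (simp add: t_def)
    have "of_int q * (of_int n + s * of_int p) = of_int d / 2 + of_int q * (2 * of_int l) \<or>
      of_int q * (of_int n + s * of_int p) = of_int q * (2 * of_int l) - of_int d / 2"
      using l 2 by (metis distrib_left right_diff_distrib)
    then have "of_int d = (of_int (2 * (q * n + p * (2 * k - m)) - 4 * (q * l)) :: real) \<or>
      of_int d = (of_int (4 * (q * l) - 2 * (q * n + p * (2 * k - m))) :: real)"
      unfolding 1 by auto
    then have "even d" unfolding of_int_eq_iff by auto
    then have "even e" using b by (simp add: e_def)
    then show False using e1 by (metis dvd_abs_iff odd_one)
  qed
  show ?thesis by (rule that[OF e1[unfolded e_def] \<open>b \<noteq> 0\<close>]) (simp add: L(2) Lxy)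
qed

text \<open>In angular coordinates \<open>z = cis (pi \<alpha>)\<close>, \<open>w = cis (pi \<beta>)\<close> on the common torus, the pillowcase
  coordinates are \<open>(A \<alpha>, \<beta> + B \<alpha>)\<close> from the first solid torus and \<open>(C \<beta>, \<alpha> + D \<beta>)\<close> from the
  second. The matrix of \<open>h\<close> with determinant \<open>e\<close> takes the former to the latter exactly if
  \<open>a A + b B = 0\<close>, \<open>c A + d B = 1\<close>, \<open>C = b\<close> and \<open>D = d\<close>; the solution is \<open>A = - e b\<close> and \<open>B = e a\<close>.\<close>

lemma two_bridge_dihedral_cover:
  assumes "two_bridge_gluing p q h" "q \<noteq> 0"
  shows "\<exists>A B C D. dihedral_cover A B C D h"
proof -
  obtain a b c d :: int where e: "\<bar>a * d - b * c\<bar> = 1" and b: "b \<noteq> 0" and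
    abcd: "\<And>x y. h (pillow_map (x, y)) = pillow_map (of_int a * x + of_int b * y, of_int c * x + of_int d * y)"
    using two_bridge_gluing_matrix[OF assms] by metis
  define e where "e = a * d - b * c"
  have ae: "\<bar>e\<bar> = 1" using e by (simp only: e_def)
  then have ee: "e * e = 1" by (metis abs_mult_self_eq mult_1)
  have "dihedral_cover (- e * b) (e * a) b d h"
  proof
    show "- e * b \<noteq> 0" using b ee by auto
    show "\<bar>b\<bar> = \<bar>- e * b\<bar>" using ae by (simp add: abs_mult)
    have "e * a * d - 1 = e * (a * d - e)" using ee by (simp add: algebra_simps)
    also have "\<dots> = (- e * b) * (- c)"
      unfolding e_def by (simp add: algebra_simps)
    finally show "- e * b dvd e * a * d - 1" by (metis dvd_triv_left)
    show "homeomorphic_map (top_of_set (frontier tangle_ball)) (top_of_set (frontier tangle_ball)) h"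
      using assms(1) by (simp add: two_bridge_gluing_def)
    fix z w :: complex assume "cmod z = 1" "cmod w = 1"
    moreover have "\<exists>\<alpha>. u = cis (pi * \<alpha>)" if "cmod u = 1" for u
    proof -
      have "u \<noteq> 0" using that by auto
      then have "u = cis (pi * (Arg u / pi))" using that by (simp add: cis_Arg sgn_div_norm)
      then show ?thesis by blast
    qed
    ultimately obtain \<alpha> \<beta> where zw: "z = cis (pi * \<alpha>)" "w = cis (pi * \<beta>)" by blast
    have fold: "wrapped_fold m n (cis (pi * x), cis (pi * y)) = pillow_map (of_int m * x, y + of_int n * x)" for m n x y
      by (simp add: wrapped_fold_def cis_power_int cis_mult solid_fold_cis[symmetric] algebra_simps)
    have er: "of_int e * of_int e = (1 :: real)" using ee by (metis of_int_1 of_int_mult)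
    have 1: "of_int a * (of_int (- e * b) * \<alpha>) + of_int b * (\<beta> + of_int (e * a) * \<alpha>) = of_int b * \<beta>"
      by (simp add: algebra_simps)
    have "of_int c * (of_int (- e * b) * \<alpha>) + of_int d * (\<beta> + of_int (e * a) * \<alpha>) = of_int e * of_int (a * d - b * c) * \<alpha> + of_int d * \<beta>"
      by (simp add: algebra_simps)
    then have 2: "of_int c * (of_int (- e * b) * \<alpha>) + of_int d * (\<beta> + of_int (e * a) * \<alpha>) = \<alpha> + of_int d * \<beta>"
      using er by (simp add: e_def)
    show "h (wrapped_fold (- e * b) (e * a) (z, w)) = wrapped_fold b d (w, z)"
      unfolding zw fold abcd 1 2 ..
  qed
  then show ?thesis by blast
qed

theorem theorem3:
  fixes p q :: int and h :: "real \<times> real \<times> real \<Rightarrow> real \<times> real \<times> real"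
  assumes "coprime p q" and "q \<noteq> 0"
    and "two_bridge_gluing p q h"
  shows "virtually_fibered (two_bridge_complement h)"
proof -
  obtain A B C D where "dihedral_cover A B C D h"
    using two_bridge_dihedral_cover[OF assms(3,2)] by blast
  then interpret dihedral_cover A B C D h .
  show ?thesis
    unfolding virtually_fibered_def
    using finite_sheeted_covering_orbit_map fibered_circle_link_complement[OF A BD] by blast
qed

end
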